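(* Let $R$ be a ring such that $R_{\mathrm{red}}$ is $F$-finite, let $M$ be an $R$-module, and let $\mathfrak p_1, \dotsc, \mathfrak p_n$ be the minimal primes of $R$. Then $$M_{*R} = \sum_{i=1}^n (0 :_M \mathfrak p_i)_{*(R/\mathfrak p_i)},$$ where $(0:_M\mathfrak p_i)=\{m\in M:\mathfrak p_im=0\}$ is regarded as an $R/\mathfrak p_i$-module.
   Context: Rings are commutative Noetherian of prime characteristic $p>0$. A ring is $F$-finite if its Frobenius endomorphism is a finite map. $R_{\mathrm{red}}$ is $R$ modulo its nilradical. $R^\circ$ is the set of elements of $R$ not contained in any minimal prime. For an $R$-module $M$ and $e\ge 0$, ${}^eM=\{{}^ex : x\in M\}$ is $M$ as an abelian group, with $R$-module structure $r\cdot{}^ex={}^e(r^{p^e}x)$. For $c\in R^\circ$ and $e_0\ge 0$ put $M_*[c,p^{e_0}]=\sum_{e\ge e_0}\operatorname{im}(\operatorname{Hom}_R({}^eR,M)\to M,\ g\mapsto g({}^ec))$. The tight interior of $M$ over $R$ is $M_{*R}=\bigcap_{c\in R^\circ}\bigcap_{e_0\ge0}M_*[c,p^{e_0}]$; a subscript $*S$ means the tight interior is computed over the ring $S$. *)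

theory Defs
  imports "HOL-Algebra.Algebra"
begin

section \<open>Rings of prime characteristic\<close>

definition has_characteristic :: "('a, 'm) ring_scheme \<Rightarrow> nat \<Rightarrow> bool" where
  "has_characteristic R p \<longleftrightarrow> (\<forall>n::nat. [n] \<cdot>\<^bsub>R\<^esub> \<one>\<^bsub>R\<^esub> = \<zero>\<^bsub>R\<^esub> \<longleftrightarrow> p dvd n)"

definition frobenius :: "nat \<Rightarrow> ('a, 'm) ring_scheme \<Rightarrow> 'a \<Rightarrow> 'a" where
  "frobenius p R = (\<lambda>x. x [^]\<^bsub>R\<^esub> p)"

definition nilradical :: "('a, 'm) ring_scheme \<Rightarrow> 'a set" where
  "nilradical R = {x \<in> carrier R. \<exists>n::nat. x [^]\<^bsub>R\<^esub> n = \<zero>\<^bsub>R\<^esub>}"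

definition reduced_ring :: "('a, 'm) ring_scheme \<Rightarrow> 'a set ring" where
  "reduced_ring R = R Quot nilradical R"

definition minimal_primes :: "('a, 'm) ring_scheme \<Rightarrow> 'a set set" where
  "minimal_primes R = {P. primeideal P R \<and> (\<forall>Q. primeideal Q R \<and> Q \<subseteq> P \<longrightarrow> Q = P)}"

text \<open>The set usually written \<open>R\<close> with a superscript circle.\<close>

definition avoiding_minimal_primes :: "('a, 'm) ring_scheme \<Rightarrow> 'a set" where
  "avoiding_minimal_primes R = {c \<in> carrier R. \<forall>P \<in> minimal_primes R. c \<notin> P}"

section \<open>Modules\<close>

definition self_module :: "('a, 'm) ring_scheme \<Rightarrow> ('a, 'a) module" where
  "self_module R = \<lparr>carrier = carrier R, monoid.mult = monoid.mult R,
     one = monoid.one R, ring.zero = ring.zero R,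
     ring.add = ring.add R, smult = monoid.mult R\<rparr>"

definition restrict_scalars :: "('a \<Rightarrow> 'c) \<Rightarrow> ('c, 'b) module \<Rightarrow> ('a, 'b) module" where
  "restrict_scalars f M = \<lparr>carrier = carrier M, monoid.mult = monoid.mult M,
     one = monoid.one M, ring.zero = ring.zero M,
     ring.add = ring.add M, smult = (\<lambda>r x. f r \<odot>\<^bsub>M\<^esub> x)\<rparr>"

text \<open>As with \<^const>\<open>ring_hom\<close>, homomorphisms are arbitrary outside the carrier.\<close>

definition module_hom ::
    "('a, 'm) ring_scheme \<Rightarrow> ('a, 'b) module \<Rightarrow> ('a, 'c) module \<Rightarrow> ('b \<Rightarrow> 'c) set" where
  "module_hom R M N = {g \<in> carrier M \<rightarrow> carrier N.
     (\<forall>x \<in> carrier M. \<forall>y \<in> carrier M. g (x \<oplus>\<^bsub>M\<^esub> y) = g x \<oplus>\<^bsub>N\<^esub> g y) \<and>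
     (\<forall>r \<in> carrier R. \<forall>x \<in> carrier M. g (r \<odot>\<^bsub>M\<^esub> x) = r \<odot>\<^bsub>N\<^esub> g x)}"

definition finitely_generated_module :: "('a, 'm) ring_scheme \<Rightarrow> ('a, 'b) module \<Rightarrow> bool" where
  "finitely_generated_module R M \<longleftrightarrow> (\<exists>A. finite A \<and> A \<subseteq> carrier M \<and>
     carrier M = {(\<Oplus>\<^bsub>M\<^esub>a\<in>A. f a \<odot>\<^bsub>M\<^esub> a) | f. f \<in> A \<rightarrow> carrier R})"

definition finite_ring_hom ::
    "('a, 'm) ring_scheme \<Rightarrow> ('b, 'n) ring_scheme \<Rightarrow> ('a \<Rightarrow> 'b) \<Rightarrow> bool" where
  "finite_ring_hom R S f \<longleftrightarrow>
     f \<in> ring_hom R S \<and> finitely_generated_module R (restrict_scalars f (self_module S))"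

definition F_finite :: "nat \<Rightarrow> ('a, 'm) ring_scheme \<Rightarrow> bool" where
  "F_finite p R \<longleftrightarrow> finite_ring_hom R R (frobenius p R)"

text \<open>The sum of a possibly infinite family of submodules: all sums of finitely many elements
  taken from members of the family.\<close>

definition submodule_sum :: "('a, 'b) module \<Rightarrow> 'i set \<Rightarrow> ('i \<Rightarrow> 'b set) \<Rightarrow> 'b set" where
  "submodule_sum M I N =
     {(\<Oplus>\<^bsub>M\<^esub>i\<in>F. x i) | F x. finite F \<and> F \<subseteq> I \<and> (\<forall>i\<in>F. x i \<in> N i)}"

definition annihilated_elements ::
    "('a, 'b) module \<Rightarrow> 'a set \<Rightarrow> 'b set" where
  "annihilated_elements M I = {m \<in> carrier M. \<forall>a\<in>I. a \<odot>\<^bsub>M\<^esub> m = \<zero>\<^bsub>M\<^esub>}"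

text \<open>\<open>(0 :\<^sub>M I)\<close> with scalars in \<open>R Quot I\<close>: a coset \<open>A\<close> acts by the value \<open>a \<odot> m\<close> common to all
  its representatives \<open>a\<close>; see \<open>annihilated_module_smult\<close> below.\<close>

definition annihilated_module ::
    "('a, 'b) module \<Rightarrow> 'a set \<Rightarrow> ('a set, 'b) module" where
  "annihilated_module M I = \<lparr>carrier = annihilated_elements M I, monoid.mult = monoid.mult M,
     one = monoid.one M,
     ring.zero = ring.zero M, ring.add = ring.add M, smult = (\<lambda>A m. the_elem ((\<lambda>a. a \<odot>\<^bsub>M\<^esub> m) ` A))\<rparr>"

lemma annihilated_module_smult:
  assumes "module R M" "ideal I R" "r \<in> carrier R" "m \<in> annihilated_elements M I"
  shows "(I +>\<^bsub>R\<^esub> r) \<odot>\<^bsub>annihilated_module M I\<^esub> m = r \<odot>\<^bsub>M\<^esub> m"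
proof -
  interpret module R M by fact
  interpret I: ideal I R by fact
  have m: "m \<in> carrier M" "\<And>a. a \<in> I \<Longrightarrow> a \<odot>\<^bsub>M\<^esub> m = \<zero>\<^bsub>M\<^esub>"
    using assms(4) by (auto simp: annihilated_elements_def)
  have "b \<odot>\<^bsub>M\<^esub> m = r \<odot>\<^bsub>M\<^esub> m" if b: "b \<in> I +>\<^bsub>R\<^esub> r" for b
  proof -
    from b obtain a where a: "a \<in> I" "b = a \<oplus>\<^bsub>R\<^esub> r"
      by (auto simp: a_r_coset_def r_coset_def)
    have "b \<odot>\<^bsub>M\<^esub> m = a \<odot>\<^bsub>M\<^esub> m \<oplus>\<^bsub>M\<^esub> r \<odot>\<^bsub>M\<^esub> m"
      unfolding a(2) by (rule smult_l_distr[OF I.a_Hcarr[OF a(1)] assms(3) m(1)])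
    also have "\<dots> = r \<odot>\<^bsub>M\<^esub> m"
      unfolding m(2)[OF a(1)] by (rule M.l_zero[OF smult_closed[OF assms(3) m(1)]])
    finally show ?thesis .
  qed
  moreover have "r \<in> I +>\<^bsub>R\<^esub> r"
    using assms(3) by (rule I.a_rcos_self)
  ultimately have "(\<lambda>a. a \<odot>\<^bsub>M\<^esub> m) ` (I +>\<^bsub>R\<^esub> r) = {r \<odot>\<^bsub>M\<^esub> m}"
    by blast
  then show ?thesis
    by (simp add: annihilated_module_def)
qed

section \<open>Tight interior\<close>

text \<open>\<open>frobenius_pushforward p e R M\<close> is the module written \<open>M\<close> with a left superscript \<open>e\<close>: the
  underlying group of \<open>M\<close>, on which \<open>r\<close> acts as its \<open>p ^ e\<close>-th power.\<close>

definition frobenius_pushforward ::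
    "nat \<Rightarrow> nat \<Rightarrow> ('a, 'm) ring_scheme \<Rightarrow> ('a, 'b) module \<Rightarrow> ('a, 'b) module" where
  "frobenius_pushforward p e R M = restrict_scalars (\<lambda>r. r [^]\<^bsub>R\<^esub> (p ^ e)) M"

definition tight_interior_at ::
    "nat \<Rightarrow> ('a, 'm) ring_scheme \<Rightarrow> ('a, 'b) module \<Rightarrow> 'a \<Rightarrow> nat \<Rightarrow> 'b set" where
  "tight_interior_at p R M c e\<^sub>0 = submodule_sum M {e\<^sub>0..}
     (\<lambda>e. (\<lambda>g. g c) ` module_hom R (frobenius_pushforward p e R (self_module R)) M)"

definition tight_interior :: "nat \<Rightarrow> ('a, 'm) ring_scheme \<Rightarrow> ('a, 'b) module \<Rightarrow> 'b set" where
  "tight_interior p R M =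
     (\<Inter>c \<in> avoiding_minimal_primes R. \<Inter>e\<^sub>0. tight_interior_at p R M c e\<^sub>0)"

end

theory Submission
  imports Defs
begin

text \<open>
  An element of \<open>Hom\<^sub>R(\<^sup>eR, M)\<close> is treated as a Cartier map: an additive map \<open>g\<close> from \<open>R\<close> to \<open>M\<close> with
  \<open>g (r\<^sup>q x) = r g x\<close> for \<open>q = p\<^sup>e\<close>. For a minimal prime \<open>P\<close>, Cartier maps from \<open>R/P\<close> to \<open>(0 :\<^sub>M P)\<close> are the
  same as Cartier maps from \<open>R\<close> to \<open>M\<close> that vanish on \<open>P\<close> (\<open>inflate_cartier_map\<close>,
  \<open>deflate_cartier_map\<close>). Inflation gives the inclusion of the right-hand side in the left-hand side.

  For the other inclusion, let \<open>z\<close> be in the tight interior of \<open>M\<close>. For each \<open>P\<close> choose \<open>u\<^sub>P\<close> outside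
  \<open>P\<close> but in all other minimal primes, and any \<open>d\<^sub>P\<close> outside \<open>P\<close>. Then \<open>c = \<Sum> u\<^sub>P d\<^sub>P\<close> and its powers avoid
  all minimal primes. Take \<open>q = p\<^sup>k\<close> so large that \<open>q\<close>-th powers kill the nilradical, and write \<open>z\<close> as a
  sum of values \<open>g (c\<^sup>q)\<close> of Cartier maps of level at least \<open>k\<close>. Each \<open>h x = g (x\<^sup>q)\<close> is a Cartier map
  that kills nilpotents, and \<open>x \<mapsto> h (u\<^sub>P x)\<close> vanishes on \<open>P\<close> because \<open>u\<^sub>P P\<close> is nilpotent. So \<open>h c\<close> is the sum over
  \<open>P\<close> of values at \<open>d\<^sub>P\<close> of Cartier maps from \<open>R/P\<close> to \<open>(0 :\<^sub>M P)\<close>.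

  This decomposition depends on the choice of the \<open>d\<^sub>P\<close>, while the theorem asks for one
  decomposition whose parts work for all \<open>d\<^sub>P\<close> simultaneously. The gap is closed by a test element
  (\<open>ex_test_element\<close>): every F-finite Noetherian domain \<open>S\<close> contains some \<open>c \<noteq> 0\<close> such that the values at
  \<open>c\<close> of Cartier maps into any module already lie in its tight interior. Taking \<open>d\<^sub>P\<close> to be a lift of
  such an element for \<open>R/P\<close> finishes the proof.

  The usual construction of test elements inverts an element that makes the ring regular; here
  freeness over the subring of \<open>p\<close>-th powers takes the place of regularity. Over this subring \<open>S\<close> is
  free up to some denominator \<open>s\<close>, with coordinates given by Cartier maps (\<open>ex_cartier_coordinates\<close>). For \<open>d \<noteq> 0\<close> let
  \<open>J\<close> be the ideal of all sums of values \<open>\<phi> d\<close> of Cartier maps on \<open>S\<close>, saturated with respect to \<open>s\<close>. It is stable under the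
  coordinate maps, and \<open>s\<^sup>p x = \<Sum> (\<phi>\<^sub>b x)\<^sup>p b\<close> shows \<open>s\<^sup>p J \<subseteq> J\<^sup>2\<close>. Nakayama's lemma
  (\<open>power_mem_of_mult_into_square\<close>) then puts a power of \<open>s\<close> into \<open>J\<close>, and an
  exponent-halving argument (\<open>ex_uniform_test_element\<close>) makes the exponent independent of \<open>d\<close>.
\<close>

section \<open>Sums of submodules\<close>

text \<open>A copy of the locale \<^locale>\<open>module\<close> in which \<open>M\<close> is a plain \<open>module\<close> record, the type on
  which the tight interior is defined.\<close>

locale module_over = module R M
  for R :: "('a, 'm) ring_scheme" (structure) and M :: "('a, 'b) module" (structure)

context module_over
begin

lemma submodule_sum_memI:
  assumes "i \<in> I" "x \<in> N i" "x \<in> carrier M"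
  shows "x \<in> submodule_sum M I N"
proof -
  have "(\<Oplus>\<^bsub>M\<^esub>j\<in>{i}. x) = x"
    using assms by simp
  then show ?thesis
    unfolding submodule_sum_def using assms
    by (intro CollectI exI[of _ "{i}"] exI[of _ "\<lambda>_. x"]) auto
qed

lemma zero_in_submodule_sum: "\<zero>\<^bsub>M\<^esub> \<in> submodule_sum M I N"
  unfolding submodule_sum_def by (intro CollectI exI[of _ "{}"]) auto

text \<open>Together with the two lemmas above and closure under addition below, this characterises the sum
  as the least additively closed set that contains every member of the family. All later arguments
  about sums and about \<^const>\<open>tight_interior_at\<close> go through this property instead of through
  explicit finite sums.\<close>

lemma submodule_sum_least:
  assumes "x \<in> submodule_sum M I N"
    and "\<And>i. i \<in> I \<Longrightarrow> N i \<subseteq> U" and "U \<subseteq> carrier M"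
    and "\<zero>\<^bsub>M\<^esub> \<in> U" and "\<And>x y. x \<in> U \<Longrightarrow> y \<in> U \<Longrightarrow> x \<oplus>\<^bsub>M\<^esub> y \<in> U"
  shows "x \<in> U"
proof -
  obtain F f where F: "finite F" "F \<subseteq> I" "\<forall>i\<in>F. f i \<in> N i" and x: "x = (\<Oplus>\<^bsub>M\<^esub>i\<in>F. f i)"
    using assms(1) by (auto simp: submodule_sum_def)
  have "(\<Oplus>\<^bsub>M\<^esub>i\<in>F. f i) \<in> U"
    using F
  proof (induction F)
    case empty
    then show ?case using assms(4) by simp
  next
    case (insert i F)
    have "f j \<in> carrier M" if "j \<in> insert i F" for j
      using insert.prems assms(2,3) that by blast
    then have "(\<Oplus>\<^bsub>M\<^esub>i\<in>insert i F. f i) = f i \<oplus>\<^bsub>M\<^esub> (\<Oplus>\<^bsub>M\<^esub>i\<in>F. f i)"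
      using insert.hyps by (intro M.finsum_insert) auto
    then show ?case
      using insert assms(2,5) by auto
  qed
  then show ?thesis using x by simp
qed

lemma submodule_sum_closed:
  assumes "x \<in> submodule_sum M I N" and "\<And>i. i \<in> I \<Longrightarrow> N i \<subseteq> carrier M"
  shows "x \<in> carrier M"
  using submodule_sum_least[OF assms(1), of "carrier M"] assms(2) by auto

text \<open>Two sums over different finite index sets are first extended by zero to the union of these
  sets.\<close>

lemma submodule_sum_add:
  assumes x: "x \<in> submodule_sum M I N" and y: "y \<in> submodule_sum M I N"
    and carr: "\<And>i. i \<in> I \<Longrightarrow> N i \<subseteq> carrier M"
    and zero: "\<And>i. i \<in> I \<Longrightarrow> \<zero>\<^bsub>M\<^esub> \<in> N i"
    and add: "\<And>i x y. i \<in> I \<Longrightarrow> x \<in> N i \<Longrightarrow> y \<in> N i \<Longrightarrow> x \<oplus>\<^bsub>M\<^esub> y \<in> N i"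
  shows "x \<oplus>\<^bsub>M\<^esub> y \<in> submodule_sum M I N"
proof -
  have carr': "z \<in> carrier M" if "z \<in> N i" "i \<in> I" for z i
    using carr that by blast
  have extend: "\<exists>f. (\<forall>i\<in>H. f i \<in> N i) \<and> z = (\<Oplus>\<^bsub>M\<^esub>i\<in>H. f i)"
    if "finite H" "F \<subseteq> H" "H \<subseteq> I" "\<forall>i\<in>F. f i \<in> N i" "z = (\<Oplus>\<^bsub>M\<^esub>i\<in>F. f i)" for z F f H
  proof -
    define f' where "f' = (\<lambda>i. if i \<in> F then f i else \<zero>\<^bsub>M\<^esub>)"
    have "(\<Oplus>\<^bsub>M\<^esub>i\<in>F. f i) = (\<Oplus>\<^bsub>M\<^esub>i\<in>H. f' i)"
      using that(1-3) carr'[OF bspec[OF that(4)]] by (intro M.add.finprod_mono_neutral_cong_left) (auto simp: f'_def)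
    moreover have "\<forall>i\<in>H. f' i \<in> N i"
      using that zero by (auto simp: f'_def)
    ultimately show ?thesis using that by blast
  qed
  obtain F f where F: "finite F" "F \<subseteq> I" "\<forall>i\<in>F. f i \<in> N i" "x = (\<Oplus>\<^bsub>M\<^esub>i\<in>F. f i)"
    using x by (auto simp: submodule_sum_def)
  obtain G g where G: "finite G" "G \<subseteq> I" "\<forall>i\<in>G. g i \<in> N i" "y = (\<Oplus>\<^bsub>M\<^esub>i\<in>G. g i)"
    using y by (auto simp: submodule_sum_def)
  define H where "H = F \<union> G"
  have H: "finite H" "H \<subseteq> I" "F \<subseteq> H" "G \<subseteq> H"
    using F G by (auto simp: H_def)
  obtain f' where f': "\<forall>i\<in>H. f' i \<in> N i" "x = (\<Oplus>\<^bsub>M\<^esub>i\<in>H. f' i)"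
    using extend[OF H(1,3,2) F(3,4)] by blast
  obtain g' where g': "\<forall>i\<in>H. g' i \<in> N i" "y = (\<Oplus>\<^bsub>M\<^esub>i\<in>H. g' i)"
    using extend[OF H(1,4,2) G(3,4)] by blast
  have "x \<oplus>\<^bsub>M\<^esub> y = (\<Oplus>\<^bsub>M\<^esub>i\<in>H. f' i \<oplus>\<^bsub>M\<^esub> g' i)"
    using f' g' H by (subst M.finsum_addf) (auto simp: Pi_def intro!: carr')
  then show ?thesis
    unfolding submodule_sum_def using H f'(1) g'(1) add
    by (intro CollectI exI[of _ H] exI[of _ "\<lambda>i. f' i \<oplus>\<^bsub>M\<^esub> g' i"]) auto
qed

end

section \<open>Cartier maps\<close>

text \<open>An element of \<open>Hom\<^sub>R(\<^sup>eR, M)\<close> is an additive map \<open>g\<close> on the ring \<open>R\<close> itself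
  with \<open>g (r\<^sup>q x) = r g x\<close> for \<open>q = p\<^sup>e\<close>, that is, a \<open>p\<^sup>-\<^sup>e\<close>-linear or Cartier map. In
  this form such maps for different \<open>e\<close> can be composed with each other.\<close>

abbreviation cartier_maps ::
    "nat \<Rightarrow> nat \<Rightarrow> ('a, 'm) ring_scheme \<Rightarrow> ('a, 'b) module \<Rightarrow> ('a \<Rightarrow> 'b) set" where
  "cartier_maps p e R M \<equiv> module_hom R (frobenius_pushforward p e R (self_module R)) M"

lemma cartier_maps_iff:
  "g \<in> cartier_maps p e R M \<longleftrightarrow> g \<in> carrier R \<rightarrow> carrier M \<and>
    (\<forall>x\<in>carrier R. \<forall>y\<in>carrier R. g (x \<oplus>\<^bsub>R\<^esub> y) = g x \<oplus>\<^bsub>M\<^esub> g y) \<and>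
    (\<forall>r\<in>carrier R. \<forall>x\<in>carrier R. g (r [^]\<^bsub>R\<^esub> (p ^ e) \<otimes>\<^bsub>R\<^esub> x) = r \<odot>\<^bsub>M\<^esub> g x)"
  by (simp add: module_hom_def frobenius_pushforward_def restrict_scalars_def self_module_def)

lemma cartier_mapsD:
  assumes "g \<in> cartier_maps p e R M"
  shows "x \<in> carrier R \<Longrightarrow> g x \<in> carrier M"
    and "x \<in> carrier R \<Longrightarrow> y \<in> carrier R \<Longrightarrow> g (x \<oplus>\<^bsub>R\<^esub> y) = g x \<oplus>\<^bsub>M\<^esub> g y"
    and "r \<in> carrier R \<Longrightarrow> x \<in> carrier R \<Longrightarrow> g (r [^]\<^bsub>R\<^esub> (p ^ e) \<otimes>\<^bsub>R\<^esub> x) = r \<odot>\<^bsub>M\<^esub> g x"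
  using assms by (auto simp: cartier_maps_iff)

lemma self_module_simps [simp]:
  "carrier (self_module R) = carrier R" "x \<oplus>\<^bsub>self_module R\<^esub> y = x \<oplus>\<^bsub>R\<^esub> y"
  "\<zero>\<^bsub>self_module R\<^esub> = \<zero>\<^bsub>R\<^esub>" "a \<odot>\<^bsub>self_module R\<^esub> x = a \<otimes>\<^bsub>R\<^esub> x"
  by (simp_all add: self_module_def)

lemma (in cring) module_over_self: "module_over R (self_module R)"
proof -
  have "abelian_group (self_module R)"
  proof (rule abelian_groupI)
    fix x assume "x \<in> carrier (self_module R)"
    then show "\<exists>y\<in>carrier (self_module R). y \<oplus>\<^bsub>self_module R\<^esub> x = \<zero>\<^bsub>self_module R\<^esub>"
      by (intro bexI[of _ "\<ominus> x"]) (auto simp: l_neg)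
  qed (auto simp: a_ac)
  then show ?thesis
    unfolding module_over_def
    by (intro moduleI) (auto simp: cring_axioms l_distr r_distr m_assoc)
qed

context module_over
begin

lemma cartier_map_zero:
  assumes "g \<in> cartier_maps p e R M"
  shows "g \<zero> = \<zero>\<^bsub>M\<^esub>"
proof -
  have "g \<zero> \<oplus>\<^bsub>M\<^esub> g \<zero> = g \<zero>"
    using cartier_mapsD(2)[OF assms, of \<zero> \<zero>] by simp
  then show ?thesis
    using cartier_mapsD(1)[OF assms, of \<zero>]
      M.add.r_cancel_one'[of "g \<zero>" "g \<zero>"] by simp
qed

lemma zero_cartier_map: "(\<lambda>_. \<zero>\<^bsub>M\<^esub>) \<in> cartier_maps p e R M"
  by (auto simp: cartier_maps_iff)

lemma add_cartier_maps:
  assumes "g \<in> cartier_maps p e R M" "h \<in> cartier_maps p e R M"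
  shows "(\<lambda>x. g x \<oplus>\<^bsub>M\<^esub> h x) \<in> cartier_maps p e R M"
  using assms by (auto simp: cartier_maps_iff Pi_iff M.a_ac smult_r_distr)

lemma smult_cartier_map:
  assumes "g \<in> cartier_maps p e R M" "a \<in> carrier R"
  shows "(\<lambda>x. a \<odot>\<^bsub>M\<^esub> g x) \<in> cartier_maps p e R M"
proof -
  have "a \<odot>\<^bsub>M\<^esub> (r \<odot>\<^bsub>M\<^esub> g x) = r \<odot>\<^bsub>M\<^esub> (a \<odot>\<^bsub>M\<^esub> g x)"
    if "r \<in> carrier R" "x \<in> carrier R" for r x
    using that assms(2) cartier_mapsD(1)[OF assms(1)] by (metis R.m_comm smult_assoc1)
  then show ?thesis
    using assms by (auto simp: cartier_maps_iff Pi_iff smult_r_distr)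
qed

lemma cartier_map_mult_arg:
  assumes "g \<in> cartier_maps p e R M" "a \<in> carrier R"
  shows "(\<lambda>x. g (a \<otimes> x)) \<in> cartier_maps p e R M"
proof -
  have "a \<otimes> (r [^] (p ^ e) \<otimes> x) = r [^] (p ^ e) \<otimes> (a \<otimes> x)"
    if "r \<in> carrier R" "x \<in> carrier R" for r x
    using that assms(2) by (intro R.m_lcomm) auto
  then show ?thesis
    using assms by (auto simp: cartier_maps_iff Pi_iff R.r_distr)
qed

text \<open>The exponents add up because \<open>r\<close> raised to \<open>p^(e + e')\<close> passes through \<open>f\<close> as \<open>r\<close> raised to
  \<open>p^e\<close>, and this then passes through \<open>g\<close> as \<open>r\<close>.\<close>

lemma comp_cartier_maps:
  assumes g: "g \<in> cartier_maps p e R M" and f: "f \<in> cartier_maps p e' R (self_module R)"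
  shows "g \<circ> f \<in> cartier_maps p (e + e') R M"
proof -
  have "g (f (r [^] (p ^ (e + e')) \<otimes> x)) = r \<odot>\<^bsub>M\<^esub> g (f x)"
    if "r \<in> carrier R" "x \<in> carrier R" for r x
  proof -
    have "r [^] (p ^ (e + e')) = (r [^] (p ^ e)) [^] (p ^ e')"
      using that by (simp add: R.nat_pow_pow power_add)
    then show ?thesis
      using that cartier_mapsD(3)[OF f, of "r [^] (p ^ e)" x]
        cartier_mapsD(3)[OF g, of r "f x"] cartier_mapsD(1)[OF f, of x] by simp
  qed
  then show ?thesis
    using g f by (auto simp: cartier_maps_iff Pi_iff)
qed

lemma tight_interior_at_memI:
  assumes "g \<in> cartier_maps p e R M" "e\<^sub>0 \<le> e" "c \<in> carrier R"
  shows "g c \<in> tight_interior_at p R M c e\<^sub>0"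
  unfolding tight_interior_at_def
  by (rule submodule_sum_memI[of e]) (use assms cartier_mapsD(1)[OF assms(1)] in auto)

lemma tight_interior_at_least:
  assumes "x \<in> tight_interior_at p R M c e\<^sub>0"
    and "\<And>e g. e\<^sub>0 \<le> e \<Longrightarrow> g \<in> cartier_maps p e R M \<Longrightarrow> g c \<in> U" and "U \<subseteq> carrier M"
    and "\<zero>\<^bsub>M\<^esub> \<in> U" and "\<And>x y. x \<in> U \<Longrightarrow> y \<in> U \<Longrightarrow> x \<oplus>\<^bsub>M\<^esub> y \<in> U"
  shows "x \<in> U"
proof (rule submodule_sum_least[OF assms(1)[unfolded tight_interior_at_def] _ assms(3-5)])
  fix e assume "e \<in> {e\<^sub>0..}"
  then show "(\<lambda>g. g c) ` cartier_maps p e R M \<subseteq> U"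
    using assms(2) by blast
qed

lemma tight_interior_at_closed:
  assumes "x \<in> tight_interior_at p R M c e\<^sub>0" "c \<in> carrier R"
  shows "x \<in> carrier M"
  by (rule tight_interior_at_least[OF assms(1)]) (use assms(2) cartier_mapsD(1) in auto)

lemma zero_in_tight_interior_at: "\<zero>\<^bsub>M\<^esub> \<in> tight_interior_at p R M c e\<^sub>0"
  unfolding tight_interior_at_def by (rule zero_in_submodule_sum)

lemma tight_interior_at_add:
  assumes "x \<in> tight_interior_at p R M c e\<^sub>0" "y \<in> tight_interior_at p R M c e\<^sub>0" "c \<in> carrier R"
  shows "x \<oplus>\<^bsub>M\<^esub> y \<in> tight_interior_at p R M c e\<^sub>0"
  unfolding tight_interior_at_def
proof (rule submodule_sum_add[OF assms(1,2)[unfolded tight_interior_at_def]])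
  fix e :: nat
  let ?N = "(\<lambda>g. g c) ` cartier_maps p e R M"
  show "?N \<subseteq> carrier M"
    using cartier_mapsD(1)[OF _ assms(3)] by (intro image_subsetI)
  show "\<zero>\<^bsub>M\<^esub> \<in> ?N"
    by (rule rev_image_eqI[OF zero_cartier_map]) simp
  fix x y
  assume "x \<in> ?N" "y \<in> ?N"
  then obtain g h where g: "g \<in> cartier_maps p e R M" "x = g c"
    and h: "h \<in> cartier_maps p e R M" "y = h c" by blast
  show "x \<oplus>\<^bsub>M\<^esub> y \<in> ?N"
    by (rule rev_image_eqI[OF add_cartier_maps[OF g(1) h(1)]]) (simp add: g h)
qed

lemma tight_interior_at_smult:
  assumes "x \<in> tight_interior_at p R M c e\<^sub>0" "c \<in> carrier R" "a \<in> carrier R"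
  shows "a \<odot>\<^bsub>M\<^esub> x \<in> tight_interior_at p R M c e\<^sub>0"
proof -
  let ?U = "{x \<in> carrier M. a \<odot>\<^bsub>M\<^esub> x \<in> tight_interior_at p R M c e\<^sub>0}"
  have "x \<in> ?U"
  proof (rule tight_interior_at_least[OF assms(1)])
    fix e g assume "e\<^sub>0 \<le> e" and g: "g \<in> cartier_maps p e R M"
    then show "g c \<in> ?U"
      using tight_interior_at_memI[OF smult_cartier_map[OF g assms(3)]] assms(2)
        cartier_mapsD(1)[OF g] by simp
  qed (use assms(2,3) in
      \<open>auto simp: zero_in_tight_interior_at tight_interior_at_add smult_r_distr\<close>)
  then show ?thesis by simp
qed

lemma tight_interior_at_antimono:
  assumes "x \<in> tight_interior_at p R M c e\<^sub>0" "e\<^sub>1 \<le> e\<^sub>0" "c \<in> carrier R"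
  shows "x \<in> tight_interior_at p R M c e\<^sub>1"
proof (rule tight_interior_at_least[OF assms(1)])
  show "tight_interior_at p R M c e\<^sub>1 \<subseteq> carrier M"
    using tight_interior_at_closed assms(3) by blast
qed (use assms(2,3) in \<open>auto simp: zero_in_tight_interior_at tight_interior_at_add
       intro: tight_interior_at_memI\<close>)

text \<open>If \<open>x\<close> is a sum of values \<open>\<phi> c\<close> of Cartier maps on \<open>R\<close>, then \<open>g x\<close> is the sum of the values
  at \<open>c\<close> of the composites \<open>g \<circ> \<phi>\<close>. This is how an element of \<open>R\<close> that is reached from every
  \<open>c\<close> becomes a test element for all modules at once.\<close>

lemma cartier_map_tight_interior_at:
  assumes x: "x \<in> tight_interior_at p R (self_module R) c e\<^sub>0" and g: "g \<in> cartier_maps p e R M"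
    and c: "c \<in> carrier R"
  shows "g x \<in> tight_interior_at p R M c (e + e\<^sub>0)"
proof -
  interpret self: module_over R "self_module R" by (rule R.module_over_self)
  let ?U = "{x \<in> carrier R. g x \<in> tight_interior_at p R M c (e + e\<^sub>0)}"
  have "x \<in> ?U"
  proof (rule self.tight_interior_at_least[OF x])
    fix e' f assume "e\<^sub>0 \<le> e'" and f: "f \<in> cartier_maps p e' R (self_module R)"
    then show "f c \<in> ?U"
      using tight_interior_at_memI[OF comp_cartier_maps[OF g f]] c cartier_mapsD(1)[OF f] by simp
  qed (auto simp: zero_in_tight_interior_at tight_interior_at_add c cartier_map_zero[OF g]
      cartier_mapsD(2)[OF g])
  then show ?thesis by simp
qed

lemma tight_interior_submodule:
  assumes "avoiding_minimal_primes R \<noteq> {}"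
  shows "tight_interior p R M \<subseteq> carrier M"
    and "\<zero>\<^bsub>M\<^esub> \<in> tight_interior p R M"
    and "x \<in> tight_interior p R M \<Longrightarrow> y \<in> tight_interior p R M \<Longrightarrow> x \<oplus>\<^bsub>M\<^esub> y \<in> tight_interior p R M"
proof -
  have carr: "c \<in> carrier R" if "c \<in> avoiding_minimal_primes R" for c
    using that by (simp add: avoiding_minimal_primes_def)
  show "tight_interior p R M \<subseteq> carrier M"
  proof
    fix x assume x: "x \<in> tight_interior p R M"
    obtain c where c: "c \<in> avoiding_minimal_primes R" using assms by blast
    then have "x \<in> tight_interior_at p R M c 0" using x by (simp add: tight_interior_def)
    then show "x \<in> carrier M" using carr[OF c] by (rule tight_interior_at_closed)
  qed
  show "\<zero>\<^bsub>M\<^esub> \<in> tight_interior p R M"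
    using zero_in_tight_interior_at by (simp add: tight_interior_def)
  show "x \<oplus>\<^bsub>M\<^esub> y \<in> tight_interior p R M"
    if "x \<in> tight_interior p R M" "y \<in> tight_interior p R M"
    using that carr tight_interior_at_add by (simp add: tight_interior_def)
qed

end

section \<open>Additivity of the Frobenius endomorphism\<close>

text \<open>Induction on the exponent: multiplying by \<open>x \<oplus> y\<close> shifts one copy of the sum by one index, and
  Pascal's rule combines the two copies term by term.\<close>

lemma (in cring) binomial_expansion:
  assumes x: "x \<in> carrier R" and y: "y \<in> carrier R"
  shows "(x \<oplus> y) [^] n = (\<Oplus>k\<in>{..n}. [(n choose k)] \<cdot> (x [^] k \<otimes> y [^] (n - k)))"
proof (induction n)
  case 0
  then show ?case by simp
next
  case (Suc n)
  define f where "f n k = [(n choose k)] \<cdot> (x [^] k \<otimes> y [^] (n - k))" for n k :: nat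
  have f_closed [simp]: "f n k \<in> carrier R" for n k
    using x y by (simp add: f_def)
  have pascal: "f (Suc n) (Suc k) = x \<otimes> f n k \<oplus> y \<otimes> f n (Suc k)" for k
  proof -
    have "y \<otimes> f n (Suc k) = [(n choose Suc k)] \<cdot> (x [^] Suc k \<otimes> y [^] (n - k))"
    proof (cases "k < n")
      case True
      then have "n - k = Suc (n - Suc k)" by simp
      then show ?thesis
        using x y by (simp add: f_def add_pow_rdistr m_ac)
    next
      case False
      then show ?thesis using x y by (simp add: f_def binomial_eq_0)
    qed
    moreover have "x \<otimes> f n k = [(n choose k)] \<cdot> (x [^] Suc k \<otimes> y [^] (n - k))"
      using x y by (simp add: f_def add_pow_rdistr m_ac)
    ultimately show ?thesis
      using x y by (simp add: f_def add.nat_pow_mult)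
  qed
  have "(x \<oplus> y) [^] Suc n = (x \<oplus> y) \<otimes> (\<Oplus>k\<in>{..n}. f n k)"
    using x y Suc by (simp add: f_def m_comm)
  also have "\<dots> = (\<Oplus>k\<in>{..n}. x \<otimes> f n k) \<oplus> (\<Oplus>k\<in>{..n}. y \<otimes> f n k)"
    using x y by (simp add: l_distr finsum_rdistr)
  also have "(\<Oplus>k\<in>{..n}. y \<otimes> f n k) = (\<Oplus>k\<in>{..Suc n}. y \<otimes> f n k)"
    using x y by (subst finsum_Suc) (auto simp: f_def[of n "Suc n"] binomial_eq_0)
  also have "\<dots> = (\<Oplus>k\<in>{..n}. y \<otimes> f n (Suc k)) \<oplus> y \<otimes> f n 0"
    using y by (subst finsum_Suc2) auto
  also have "y \<otimes> f n 0 = f (Suc n) 0"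
    using y by (simp add: f_def m_comm)
  also have "(\<Oplus>k\<in>{..n}. x \<otimes> f n k) \<oplus> ((\<Oplus>k\<in>{..n}. y \<otimes> f n (Suc k)) \<oplus> f (Suc n) 0)
      = (\<Oplus>k\<in>{..n}. f (Suc n) (Suc k)) \<oplus> f (Suc n) 0"
    using x y by (simp add: pascal a_assoc)
  also have "\<dots> = (\<Oplus>k\<in>{..Suc n}. f (Suc n) k)"
    by (subst finsum_Suc2) auto
  finally show ?case by (simp add: f_def)
qed

locale prime_char_cring = cring R for R (structure) +
  fixes p :: nat
  assumes prime_p: "Factorial_Ring.prime p" and char_p: "[p] \<cdot> \<one> = \<zero>"
begin

lemma add_pow_eq_zero:
  assumes "p dvd n" "x \<in> carrier R"
  shows "[n] \<cdot> x = \<zero>"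
proof -
  obtain m where n: "n = p * m" using assms(1) by blast
  have "[n] \<cdot> \<one> = \<zero>"
    using add.nat_pow_pow[of \<one> m p] by (simp add: n char_p)
  moreover have "[n] \<cdot> x = [n] \<cdot> \<one> \<otimes> x"
    using assms(2) by (simp add: add_pow_ldistr)
  ultimately show ?thesis using assms(2) by simp
qed

text \<open>Every middle binomial coefficient of \<open>p\<close> is divisible by \<open>p\<close>, so only the two outer terms of
  the expansion survive.\<close>

lemma frobenius_add_1:
  assumes x: "x \<in> carrier R" and y: "y \<in> carrier R"
  shows "(x \<oplus> y) [^] p = x [^] p \<oplus> y [^] p"
proof -
  obtain m where p: "p = Suc (Suc m)"
    using prime_ge_2_nat[OF prime_p] by (metis add_2_eq_Suc le_Suc_ex)
  let ?f = "\<lambda>k. [(p choose k)] \<cdot> (x [^] k \<otimes> y [^] (p - k))"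
  have "(\<Oplus>k\<in>{..m}. ?f (Suc k)) = (\<Oplus>k\<in>{..m}. \<zero>)"
  proof (rule finsum_cong')
    fix k assume "k \<in> {..m}"
    then have "p dvd p choose Suc k"
      using prime_p p by (intro dvd_choose_prime) auto
    then show "?f (Suc k) = \<zero>"
      using x y by (intro add_pow_eq_zero) auto
  qed auto
  then have vanish: "(\<Oplus>k\<in>{..m}. ?f (Suc k)) = \<zero>" by simp
  have "(x \<oplus> y) [^] p = (\<Oplus>k\<in>{..Suc (Suc m)}. ?f k)"
    using binomial_expansion[OF x y, of p] by (simp only: p)
  also have "\<dots> = ?f (Suc (Suc m)) \<oplus> ((\<Oplus>k\<in>{..m}. ?f (Suc k)) \<oplus> ?f 0)"
    using x y by (subst finsum_Suc, simp, subst finsum_Suc2) auto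
  also have "\<dots> = x [^] p \<oplus> y [^] p"
    using x y unfolding vanish by (simp add: p)
  finally show ?thesis .
qed

lemma frobenius_add:
  assumes x: "x \<in> carrier R" and y: "y \<in> carrier R"
  shows "(x \<oplus> y) [^] (p ^ e) = x [^] (p ^ e) \<oplus> y [^] (p ^ e)"
proof (induction e)
  case 0
  then show ?case using x y by simp
next
  case (Suc e)
  have "z [^] (p ^ Suc e) = (z [^] (p ^ e)) [^] p" if "z \<in> carrier R" for z
    using that by (simp add: nat_pow_pow mult.commute)
  then show ?case
    using x y Suc by (simp add: frobenius_add_1)
qed

end

section \<open>Minimal primes of a Noetherian ring\<close>

context ring
begin

lemma ideal_add_member:
  assumes "ideal I R" "a \<in> carrier R"
  shows "ideal (I <+>\<^bsub>R\<^esub> Idl {a}) R" "I \<subseteq> I <+>\<^bsub>R\<^esub> Idl {a}" "a \<in> I <+>\<^bsub>R\<^esub> Idl {a}"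
proof -
  have a: "ideal (Idl {a}) R" "a \<in> Idl {a}"
    using assms(2) genideal_ideal[of "{a}"] genideal_self'[of a] by auto
  interpret I: ideal I R by fact
  interpret A: ideal "Idl {a}" R by (rule a)
  show "ideal (I <+>\<^bsub>R\<^esub> Idl {a}) R"
    by (rule add_ideals[OF assms(1) a(1)])
  have sum: "i \<oplus> j \<in> I <+>\<^bsub>R\<^esub> Idl {a}" if "i \<in> I" "j \<in> Idl {a}" for i j
    using that unfolding set_add_def' by blast
  show "I \<subseteq> I <+>\<^bsub>R\<^esub> Idl {a}"
    using sum[OF _ A.zero_closed] I.Icarr by auto
  show "a \<in> I <+>\<^bsub>R\<^esub> Idl {a}"
    using sum[OF I.zero_closed a(2)] assms(2) by auto
qed

end

text \<open>Noetherian induction: chains of ideals have maximal members, so by Zorn's lemma a counterexample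
  could be chosen maximal.\<close>

lemma (in noetherian_ring) ideal_induct [consumes 1, case_names step]:
  assumes "ideal I R"
    and step: "\<And>I. ideal I R \<Longrightarrow> (\<And>J. ideal J R \<Longrightarrow> I \<subset> J \<Longrightarrow> P J) \<Longrightarrow> P I"
  shows "P I"
proof (rule ccontr)
  assume "\<not> P I"
  define \<B> where "\<B> = {I. ideal I R \<and> \<not> P I}"
  have "\<exists>M\<in>\<B>. \<forall>J\<in>\<B>. M \<subseteq> J \<longrightarrow> J = M"
  proof (rule subset_Zorn_nonempty)
    show "\<B> \<noteq> {}" using assms(1) \<open>\<not> P I\<close> by (auto simp: \<B>_def)
    fix C assume C: "C \<noteq> {}" "subset.chain \<B> C"
    then have "subset.chain {I. ideal I R} C"
      by (auto simp: pred_on.chain_def \<B>_def)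
    then have "\<Union>C \<in> C" by (rule ideal_chain_is_trivial[OF C(1)])
    then show "\<Union>C \<in> \<B>" using C(2) by (auto simp: pred_on.chain_def)
  qed
  then show False
    using step by (auto simp: \<B>_def)
qed

locale noetherian_cring = noetherian_ring R + cring R for R (structure)
begin

text \<open>Noetherian induction. The unit ideal is controlled by no prime and the exponent \<open>0\<close>, a prime
  ideal by itself. Otherwise there are \<open>a, b\<close> outside \<open>I\<close> with \<open>ab\<close> in \<open>I\<close>; since
  \<open>(I + (a)) (I + (b)) \<subseteq> I\<close> and every prime over \<open>I\<close> contains one of the two larger ideals, the
  primes for \<open>I + (a)\<close> and \<open>I + (b)\<close> together control \<open>I\<close>, with the sum of the exponents.
  The exponent does not depend on the element, so a single Frobenius power kills the nilradical.\<close>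

lemma finitely_many_primes_control_ideal:
  assumes "ideal I R"
  shows "\<exists>\<P> k. finite \<P> \<and> (\<forall>P\<in>\<P>. primeideal P R) \<and>
    (\<forall>x\<in>carrier R. (\<forall>P\<in>\<P>. x \<in> P) \<longrightarrow> x [^] (k::nat) \<in> I) \<and>
    (\<forall>Q. primeideal Q R \<and> I \<subseteq> Q \<longrightarrow> (\<exists>P\<in>\<P>. P \<subseteq> Q))"
  (is "\<exists>\<P> k. ?good \<P> k I")
  using assms
proof (induction I rule: ideal_induct)
  case (step I)
  interpret I: ideal I R by fact
  consider "I = carrier R" | "primeideal I R"
    | a b where "a \<in> carrier R" "b \<in> carrier R" "a \<otimes> b \<in> I" "a \<notin> I" "b \<notin> I"
    using I.primeidealCD[OF cring_axioms] by blast
  then show ?case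
  proof cases
    case 1
    have "\<not> primeideal Q R" if "I \<subseteq> Q" for Q
    proof
      assume "primeideal Q R"
      then interpret Q: primeideal Q R .
      show False using that 1 Q.I_notcarr Q.Icarr by auto
    qed
    then have "?good {} 0 I" using 1 by auto
    then show ?thesis by blast
  next
    case 2
    have "x [^] (1::nat) = x" if "x \<in> carrier R" for x
      using that by simp
    then have "?good {I} 1 I" using 2 by auto
    then show ?thesis by blast
  next
    case 3
    have grow: "\<exists>\<P> k. ?good \<P> k (I <+>\<^bsub>R\<^esub> Idl {c})" if c: "c \<in> carrier R" "c \<notin> I" for c
    proof (rule step.IH)
      show "ideal (I <+>\<^bsub>R\<^esub> Idl {c}) R"
        by (rule ideal_add_member(1)[OF I.is_ideal c(1)])
      show "I \<subset> I <+>\<^bsub>R\<^esub> Idl {c}"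
        using ideal_add_member(2,3)[OF I.is_ideal c(1)] c(2) by blast
    qed
    obtain \<P> k where P: "?good \<P> k (I <+>\<^bsub>R\<^esub> Idl {a})"
      using grow[OF 3(1,4)] by (elim exE)
    obtain \<Q> l where Q: "?good \<Q> l (I <+>\<^bsub>R\<^esub> Idl {b})"
      using grow[OF 3(2,5)] by (elim exE)
    have prod: "x \<otimes> y \<in> I" if "x \<in> I <+>\<^bsub>R\<^esub> Idl {a}" "y \<in> I <+>\<^bsub>R\<^esub> Idl {b}" for x y
    proof -
      obtain i r where x: "x = i \<oplus> r \<otimes> a" "i \<in> I" "r \<in> carrier R"
        using \<open>x \<in> _\<close> 3 by (auto simp: set_add_def' cgenideal_def simp flip: cgenideal_eq_genideal)
      obtain j s where y: "y = j \<oplus> s \<otimes> b" "j \<in> I" "s \<in> carrier R"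
        using \<open>y \<in> _\<close> 3 by (auto simp: set_add_def' cgenideal_def simp flip: cgenideal_eq_genideal)
      have "x \<otimes> y = i \<otimes> y \<oplus> ((r \<otimes> a) \<otimes> j \<oplus> (r \<otimes> s) \<otimes> (a \<otimes> b))"
        using x y 3 I.Icarr[of i] I.Icarr[of j] by (simp add: l_distr r_distr m_ac a_ac)
      then show ?thesis
        using x y 3 I.Icarr by (simp add: I.a_closed I.I_l_closed I.I_r_closed)
    qed
    have "?good (\<P> \<union> \<Q>) (k + l) I"
    proof (intro conjI allI ballI impI)
      fix x assume "x \<in> carrier R" "\<forall>P\<in>\<P> \<union> \<Q>. x \<in> P"
      then show "x [^] (k + l) \<in> I"
        using P Q prod[of "x [^] k" "x [^] l"] by (auto simp flip: nat_pow_mult)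
    next
      fix Q assume "primeideal Q R \<and> I \<subseteq> Q"
      then have Q': "primeideal Q R" "I \<subseteq> Q" by auto
      interpret Q: primeideal Q R by fact
      have sub: "I <+>\<^bsub>R\<^esub> Idl {c} \<subseteq> Q" if "c \<in> Q" for c
      proof -
        have "Idl {c} \<subseteq> Q" using that by (intro genideal_minimal Q.is_ideal) auto
        then show ?thesis using Q' Q.a_closed unfolding set_add_def' by blast
      qed
      from Q.I_prime[of a b] 3 Q'(2) have "a \<in> Q \<or> b \<in> Q" by blast
      then show "\<exists>P\<in>\<P> \<union> \<Q>. P \<subseteq> Q"
        using P Q sub Q'(1) by blast
    qed (use P Q in auto)
    then show ?thesis by (intro exI)
  qed
qed

lemma finitely_many_primes:
  obtains \<P> and k :: nat where "finite \<P>" "\<And>P. P \<in> \<P> \<Longrightarrow> primeideal P R"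
    "\<And>x. x \<in> carrier R \<Longrightarrow> (\<And>P. P \<in> \<P> \<Longrightarrow> x \<in> P) \<Longrightarrow> x [^] k = \<zero>"
    "\<And>Q. primeideal Q R \<Longrightarrow> \<exists>P\<in>\<P>. P \<subseteq> Q"
proof -
  have "{\<zero>} \<subseteq> Q" if "primeideal Q R" for Q
    using primeideal.axioms(1)[OF that] additive_subgroup.zero_closed ideal.axioms(1) by blast
  moreover obtain \<P> and k :: nat where P: "finite \<P>" "\<forall>P\<in>\<P>. primeideal P R"
    "\<forall>x\<in>carrier R. (\<forall>P\<in>\<P>. x \<in> P) \<longrightarrow> x [^] k \<in> {\<zero>}"
    "\<forall>Q. primeideal Q R \<and> {\<zero>} \<subseteq> Q \<longrightarrow> (\<exists>P\<in>\<P>. P \<subseteq> Q)"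
    using finitely_many_primes_control_ideal[OF zeroideal] by (elim exE conjE)
  ultimately show ?thesis
    by (intro that[of \<P> k]) auto
qed

lemma finite_minimal_primes: "finite (minimal_primes R)"
proof -
  obtain \<P> and k :: nat where P: "finite \<P>" "\<And>P. P \<in> \<P> \<Longrightarrow> primeideal P R"
    "\<And>Q. primeideal Q R \<Longrightarrow> \<exists>P\<in>\<P>. P \<subseteq> Q"
    using finitely_many_primes by metis
  have "minimal_primes R \<subseteq> \<P>"
  proof
    fix Q assume "Q \<in> minimal_primes R"
    then have Q: "primeideal Q R" "\<And>P. primeideal P R \<Longrightarrow> P \<subseteq> Q \<Longrightarrow> P = Q"
      by (auto simp: minimal_primes_def)
    obtain P where "P \<in> \<P>" "P \<subseteq> Q" using P(3)[OF Q(1)] by blast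
    then show "Q \<in> \<P>" using P(2) Q(2) by metis
  qed
  then show ?thesis using P(1) finite_subset by blast
qed

text \<open>There is a finite set of primes such that every prime contains a member of it. A member that is
  minimal for inclusion is a minimal prime of the ring, because any prime inside it contains a
  member of the same finite set.\<close>

lemma ex_minimal_prime_subset:
  assumes "primeideal Q R"
  shows "\<exists>P\<in>minimal_primes R. P \<subseteq> Q"
proof -
  obtain \<P> and k :: nat where P: "finite \<P>" "\<And>P. P \<in> \<P> \<Longrightarrow> primeideal P R"
    "\<And>Q. primeideal Q R \<Longrightarrow> \<exists>P\<in>\<P>. P \<subseteq> Q"
    using finitely_many_primes by metis
  obtain P\<^sub>0 where P0: "P\<^sub>0 \<in> \<P>" "P\<^sub>0 \<subseteq> Q" using P(3)[OF assms] by blast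
  obtain P' where P': "P' \<in> \<P>" "P' \<subseteq> P\<^sub>0" "\<And>P''. P'' \<in> \<P> \<Longrightarrow> P'' \<subseteq> P' \<Longrightarrow> P'' = P'"
    using finite_has_minimal2[OF P(1) P0(1)] by metis
  have "P' \<in> minimal_primes R"
    unfolding minimal_primes_def
  proof (intro CollectI conjI allI impI)
    show "primeideal P' R" by (rule P(2)[OF P'(1)])
    fix Q' assume Q': "primeideal Q' R \<and> Q' \<subseteq> P'"
    then obtain P'' where P'': "P'' \<in> \<P>" "P'' \<subseteq> Q'" using P(3) by metis
    then have "P'' = P'" using P'(3) Q' by (metis subset_trans)
    then show "Q' = P'" using P'' Q' by auto
  qed
  then show ?thesis using P' P0 by blast
qed

lemma intersection_minimal_primes_nilpotent:
  "\<exists>k::nat. \<forall>x\<in>carrier R. (\<forall>P\<in>minimal_primes R. x \<in> P) \<longrightarrow> x [^] k = \<zero>"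
proof -
  obtain \<P> and k :: nat where P: "\<And>P. P \<in> \<P> \<Longrightarrow> primeideal P R"
    "\<And>x. x \<in> carrier R \<Longrightarrow> (\<And>P. P \<in> \<P> \<Longrightarrow> x \<in> P) \<Longrightarrow> x [^] k = \<zero>"
    using finitely_many_primes by metis
  have "x [^] k = \<zero>" if "x \<in> carrier R" "\<forall>P\<in>minimal_primes R. x \<in> P" for x
  proof (rule P(2)[OF that(1)])
    fix P assume "P \<in> \<P>"
    then obtain P' where "P' \<in> minimal_primes R" "P' \<subseteq> P"
      using ex_minimal_prime_subset[OF P(1)] by blast
    then show "x \<in> P" using that(2) by blast
  qed
  then show ?thesis by blast
qed

end

lemma (in primeideal) pow_mem:
  assumes "x \<in> carrier R" "x [^] (n::nat) \<in> I"
  shows "x \<in> I"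
  using assms(2)
proof (induction n)
  case 0
  then have "I = carrier R" using one_imp_carrier by simp
  then show ?case using I_notcarr by simp
next
  case (Suc n)
  then show ?case using I_prime[of "x [^] n" x] assms(1) by auto
qed

text \<open>One element of each ideal outside the prime is chosen; their product is still outside.\<close>

lemma (in primeideal) ex_mem_ideals_not_mem_prime:
  assumes "finite \<Q>" "\<And>Q. Q \<in> \<Q> \<Longrightarrow> ideal Q R" "\<And>Q. Q \<in> \<Q> \<Longrightarrow> \<not> Q \<subseteq> I"
  shows "\<exists>u\<in>carrier R. u \<notin> I \<and> (\<forall>Q\<in>\<Q>. u \<in> Q)"
  using assms
proof (induction \<Q>)
  case empty
  have "\<one> \<notin> I" using one_imp_carrier I_notcarr by blast
  then show ?case by auto
next
  case (insert Q \<Q>)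
  then obtain u where u: "u \<in> carrier R" "u \<notin> I" "\<forall>Q\<in>\<Q>. u \<in> Q" by auto
  obtain v where v: "v \<in> Q" "v \<notin> I" using insert.prems(2) by blast
  have v': "v \<in> carrier R" using v(1) ideal.Icarr[OF insert.prems(1)[of Q]] by auto
  have "u \<otimes> v \<notin> I" using I_prime u v v' by blast
  moreover have "u \<otimes> v \<in> Q'" if "Q' \<in> insert Q \<Q>" for Q'
    using that u v v' ideal.I_l_closed[OF insert.prems(1)[OF that]]
      ideal.I_r_closed[OF insert.prems(1)[OF that]] by auto
  ultimately show ?case using u v' by blast
qed

section \<open>Generic coordinates over the subring of p-th powers\<close>

context prime_char_cring
begin

lemma prime_cases:
  obtains m where "p = Suc (Suc m)"
  using prime_ge_2_nat[OF prime_p] by (metis add_2_eq_Suc le_Suc_ex)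

lemma zero_pow_p [simp]: "\<zero> [^] p = \<zero>"
  using prime_p by (simp add: nat_pow_zero prime_gt_0_nat)

lemma minus_one_pow_p: "(\<ominus> \<one>) [^] p = \<ominus> \<one>"
proof -
  have "(\<ominus> \<one>) [^] p \<oplus> \<one> [^] p = \<zero>"
    using frobenius_add_1[of "\<ominus> \<one>" \<one>] by (simp add: l_neg)
  then show ?thesis using minus_equality[of "(\<ominus> \<one>) [^] p" \<one>] by simp
qed

text \<open>The module generated by \<open>B\<close> over the subring of \<open>p\<close>-th powers. Coefficients are recorded by
  their \<open>p\<close>-th roots \<open>f b\<close>, which later become Cartier maps.\<close>

definition frobenius_span :: "'a set \<Rightarrow> 'a set" where
  "frobenius_span B = {(\<Oplus>b\<in>B. f b [^] p \<otimes> b) | f. f \<in> B \<rightarrow> carrier R}"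

lemma frobenius_spanI:
  assumes "f \<in> B \<rightarrow> carrier R" "v = (\<Oplus>b\<in>B. f b [^] p \<otimes> b)"
  shows "v \<in> frobenius_span B"
  unfolding frobenius_span_def using assms by (intro CollectI exI[of _ f] conjI)

text \<open>Linear independence over the subring of \<open>p\<close>-th powers. The \<open>p\<close>-th roots of the coefficients
  are required to vanish, so that coordinates are unique as elements of \<open>R\<close>.\<close>

definition frobenius_independent :: "'a set \<Rightarrow> bool" where
  "frobenius_independent B \<longleftrightarrow>
     (\<forall>f \<in> B \<rightarrow> carrier R. (\<Oplus>b\<in>B. f b [^] p \<otimes> b) = \<zero> \<longrightarrow> (\<forall>b\<in>B. f b = \<zero>))"

context
  fixes B assumes B: "finite B" "B \<subseteq> carrier R"
begin

lemma term_closed: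
  assumes "f \<in> B \<rightarrow> carrier R" "b \<in> B"
  shows "f b [^] p \<otimes> b \<in> carrier R"
  using assms B by auto

lemma frobenius_comb_add:
  assumes f: "f \<in> B \<rightarrow> carrier R" and g: "g \<in> B \<rightarrow> carrier R"
  shows "(\<Oplus>b\<in>B. (f b \<oplus> g b) [^] p \<otimes> b) =
    (\<Oplus>b\<in>B. f b [^] p \<otimes> b) \<oplus> (\<Oplus>b\<in>B. g b [^] p \<otimes> b)"
proof -
  have "(\<Oplus>b\<in>B. (f b \<oplus> g b) [^] p \<otimes> b) = (\<Oplus>b\<in>B. f b [^] p \<otimes> b \<oplus> g b [^] p \<otimes> b)"
  proof (rule finsum_cong')
    fix b assume b: "b \<in> B"
    then have "f b \<in> carrier R" "g b \<in> carrier R" "b \<in> carrier R"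
      using f g B by auto
    then show "(f b \<oplus> g b) [^] p \<otimes> b = f b [^] p \<otimes> b \<oplus> g b [^] p \<otimes> b"
      by (simp add: frobenius_add_1 l_distr)
  qed (use f g B in \<open>auto intro!: term_closed\<close>)
  also have "\<dots> = (\<Oplus>b\<in>B. f b [^] p \<otimes> b) \<oplus> (\<Oplus>b\<in>B. g b [^] p \<otimes> b)"
    using term_closed[OF f] term_closed[OF g] by (intro finsum_addf) auto
  finally show ?thesis .
qed

lemma frobenius_comb_smult:
  assumes f: "f \<in> B \<rightarrow> carrier R" and r: "r \<in> carrier R"
  shows "(\<Oplus>b\<in>B. (r \<otimes> f b) [^] p \<otimes> b) = r [^] p \<otimes> (\<Oplus>b\<in>B. f b [^] p \<otimes> b)"
proof -
  have "(\<Oplus>b\<in>B. (r \<otimes> f b) [^] p \<otimes> b) = (\<Oplus>b\<in>B. r [^] p \<otimes> (f b [^] p \<otimes> b))"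
  proof (rule finsum_cong')
    fix b assume b: "b \<in> B"
    then have "f b \<in> carrier R" "b \<in> carrier R"
      using f B by auto
    then show "(r \<otimes> f b) [^] p \<otimes> b = r [^] p \<otimes> (f b [^] p \<otimes> b)"
      using r by (simp add: nat_pow_distrib m_assoc)
  qed (use r term_closed[OF f] in auto)
  also have "\<dots> = r [^] p \<otimes> (\<Oplus>b\<in>B. f b [^] p \<otimes> b)"
    using term_closed[OF f] B r by (intro finsum_rdistr[symmetric]) auto
  finally show ?thesis .
qed

lemma frobenius_span_closed: "v \<in> frobenius_span B \<Longrightarrow> v \<in> carrier R"
  using term_closed by (auto simp: frobenius_span_def intro!: finsum_closed)

lemma frobenius_span_add:
  assumes "v \<in> frobenius_span B" "w \<in> frobenius_span B"
  shows "v \<oplus> w \<in> frobenius_span B"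
proof -
  obtain f g where f: "f \<in> B \<rightarrow> carrier R" "v = (\<Oplus>b\<in>B. f b [^] p \<otimes> b)"
    and g: "g \<in> B \<rightarrow> carrier R" "w = (\<Oplus>b\<in>B. g b [^] p \<otimes> b)"
    using assms by (auto simp: frobenius_span_def)
  then have "(\<lambda>b. f b \<oplus> g b) \<in> B \<rightarrow> carrier R" by auto
  then show ?thesis
    by (rule frobenius_spanI) (simp add: frobenius_comb_add[OF f(1) g(1)] f(2) g(2))
qed

lemma frobenius_span_smult:
  assumes "v \<in> frobenius_span B" "r \<in> carrier R"
  shows "r [^] p \<otimes> v \<in> frobenius_span B"
proof -
  obtain f where f: "f \<in> B \<rightarrow> carrier R" "v = (\<Oplus>b\<in>B. f b [^] p \<otimes> b)"
    using assms by (auto simp: frobenius_span_def)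
  then have "(\<lambda>b. r \<otimes> f b) \<in> B \<rightarrow> carrier R" using assms by auto
  then show ?thesis
    by (rule frobenius_spanI) (simp add: frobenius_comb_smult[OF f(1) assms(2)] f(2))
qed

lemma frobenius_span_minus:
  assumes "v \<in> frobenius_span B"
  shows "\<ominus> v \<in> frobenius_span B"
  using frobenius_span_smult[OF assms, of "\<ominus> \<one>"] frobenius_span_closed[OF assms]
  by (simp add: minus_one_pow_p l_minus)

lemma frobenius_span_base:
  assumes "b \<in> B"
  shows "b \<in> frobenius_span B"
proof -
  let ?f = "\<lambda>c. if c = b then \<one> else \<zero>"
  have "(\<Oplus>c\<in>B. ?f c [^] p \<otimes> c) = (\<Oplus>c\<in>B. if b = c then c else \<zero>)"
    using B by (intro finsum_cong') auto
  also have "\<dots> = b"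
    using B assms by (intro finsum_singleton) auto
  finally show ?thesis
    by (intro frobenius_spanI[of ?f]) auto
qed

lemma zero_in_frobenius_span: "\<zero> \<in> frobenius_span B"
proof -
  have "(\<Oplus>c\<in>B. \<zero> [^] p \<otimes> c) = (\<Oplus>c\<in>B. \<zero>)"
    using B by (intro finsum_cong') auto
  then show ?thesis
    by (intro frobenius_spanI[of "\<lambda>_. \<zero>"]) auto
qed

lemma frobenius_span_finsum:
  assumes "\<And>a. a \<in> A \<Longrightarrow> h a \<in> frobenius_span B"
  shows "(\<Oplus>a\<in>A. h a) \<in> frobenius_span B"
  using assms
proof (induction A rule: infinite_finite_induct)
  case (insert a A)
  then have "h \<in> A \<rightarrow> carrier R" "h a \<in> carrier R"
    using frobenius_span_closed by auto
  with insert show ?case by (simp add: frobenius_span_add)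
qed (simp_all add: zero_in_frobenius_span)

text \<open>The difference of the two combinations is again a combination of the same shape, with
  coefficients \<open>f b - g b\<close>, since taking \<open>p\<close>-th powers is additive.\<close>

lemma frobenius_independentD:
  assumes "frobenius_independent B" and f: "f \<in> B \<rightarrow> carrier R" and g: "g \<in> B \<rightarrow> carrier R"
    and eq: "(\<Oplus>b\<in>B. f b [^] p \<otimes> b) = (\<Oplus>b\<in>B. g b [^] p \<otimes> b)" and b: "b \<in> B"
  shows "f b = g b"
proof -
  let ?h = "\<lambda>b. \<ominus> \<one> \<otimes> g b"
  let ?s = "\<Oplus>b\<in>B. g b [^] p \<otimes> b"
  have h: "?h \<in> B \<rightarrow> carrier R" using g by auto
  have s: "?s \<in> carrier R" using term_closed[OF g] by (intro finsum_closed) auto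
  have "(\<Oplus>b\<in>B. (f b \<oplus> ?h b) [^] p \<otimes> b) = ?s \<oplus> \<ominus> \<one> \<otimes> ?s"
    using frobenius_comb_add[OF f h] frobenius_comb_smult[OF g, of "\<ominus> \<one>"] eq
    by (simp add: minus_one_pow_p)
  also have "\<dots> = \<zero>" using s by (simp add: l_minus r_neg)
  finally have "f b \<oplus> ?h b = \<zero>"
    using assms(1) f h b unfolding frobenius_independent_def by (auto simp: Pi_iff)
  moreover have "f b \<in> carrier R" "g b \<in> carrier R" using f g b by auto
  ultimately show ?thesis
    by (simp add: l_minus) (metis a_inv_closed minus_equality minus_minus)
qed

end

end

text \<open>F-finiteness is stated with explicit generators over the subring of \<open>p\<close>-th powers, so that it
  can be combined directly with \<open>frobenius_span\<close>.\<close>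

locale F_finite_noetherian_domain = noetherian_domain R + prime_char_cring R p
  for R (structure) and p +
  assumes frobenius_generators:
    "\<exists>A. finite A \<and> A \<subseteq> carrier R \<and>
       (\<forall>x\<in>carrier R. \<exists>f\<in>A \<rightarrow> carrier R. x = (\<Oplus>a\<in>A. f a [^] p \<otimes> a))"
begin

text \<open>By maximality \<open>insert a B\<close> satisfies a nontrivial relation. The coefficient of \<open>a\<close> in it cannot
  vanish, for otherwise the relation would be one among the independent elements of \<open>B\<close>; this
  coefficient is the multiplier \<open>s\<close>.\<close>

lemma dependent_on_maximal_independent:
  assumes A: "finite A" "A \<subseteq> carrier R" and B: "B \<subseteq> A" "frobenius_independent B"
    and max: "\<And>B'. B' \<subseteq> A \<Longrightarrow> frobenius_independent B' \<Longrightarrow> B \<subseteq> B' \<Longrightarrow> B' = B"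
    and a: "a \<in> A"
  shows "\<exists>s\<in>carrier R. s \<noteq> \<zero> \<and> s [^] p \<otimes> a \<in> frobenius_span B"
proof (cases "a \<in> B")
  case True
  have "finite B" "B \<subseteq> carrier R" using A B(1) finite_subset by auto
  then have "\<one> [^] p \<otimes> a \<in> frobenius_span B"
    using frobenius_span_base[of B a] True by auto
  then show ?thesis by (intro bexI[of _ \<one>]) auto
next
  case False
  have B': "finite B" "B \<subseteq> carrier R" using A B(1) finite_subset by auto
  have "\<not> frobenius_independent (insert a B)"
    using max[of "insert a B"] B(1) a False by blast
  then obtain f where f: "f \<in> insert a B \<rightarrow> carrier R" "(\<Oplus>b\<in>insert a B. f b [^] p \<otimes> b) = \<zero>"
    "\<not> (\<forall>b\<in>insert a B. f b = \<zero>)"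
    unfolding frobenius_independent_def by blast
  have f': "f \<in> B \<rightarrow> carrier R" "f a \<in> carrier R" and a': "a \<in> carrier R"
    using f(1) A(2) a by auto
  let ?v = "\<Oplus>b\<in>B. f b [^] p \<otimes> b"
  have v: "?v \<in> frobenius_span B" using f'(1) by (auto simp: frobenius_span_def)
  have v': "?v \<in> carrier R" by (rule frobenius_span_closed[OF B' v])
  have sum: "f a [^] p \<otimes> a \<oplus> ?v = \<zero>"
    using f(2) finsum_insert[OF B'(1) False, of "\<lambda>b. f b [^] p \<otimes> b"] f' a'
      term_closed[OF B' f'(1)] by (auto simp: Pi_iff)
  have "f a \<noteq> \<zero>"
  proof
    assume "f a = \<zero>"
    then have "?v = \<zero>" using sum a' v' by simp
    then have "\<forall>b\<in>B. f b = \<zero>" using B(2) f'(1) by (simp add: frobenius_independent_def)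
    then show False using f(3) \<open>f a = \<zero>\<close> by simp
  qed
  moreover have "f a [^] p \<otimes> a = \<ominus> ?v"
    using sum f' a' v' by (simp add: sum_zero_eq_neg)
  ultimately show ?thesis
    using frobenius_span_minus[OF B' v] f'(2) by auto
qed

text \<open>This replaces generic freeness of \<open>R\<close> over its \<open>p\<close>-th powers: after multiplication by a fixed
  \<open>s\<^sup>p\<close>, every element is a combination of a maximal independent set \<open>B\<close> of generators, with \<open>s\<close> a
  common denominator for the finitely many generators. Uniqueness of coordinates over an independent
  set makes the \<open>p\<close>-th roots of the coordinates Cartier maps of level \<open>1\<close>.\<close>

lemma ex_cartier_coordinates:
  obtains B s \<phi> where "finite B" "B \<subseteq> carrier R" "s \<in> carrier R" "s \<noteq> \<zero>"
    "\<And>b. b \<in> B \<Longrightarrow> \<phi> b \<in> cartier_maps p 1 R (self_module R)"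
    "\<And>x. x \<in> carrier R \<Longrightarrow> s [^] p \<otimes> x = (\<Oplus>b\<in>B. \<phi> b x [^] p \<otimes> b)"
proof -
  obtain A where A: "finite A" "A \<subseteq> carrier R"
    and gen: "\<And>x. x \<in> carrier R \<Longrightarrow> \<exists>f\<in>A \<rightarrow> carrier R. x = (\<Oplus>a\<in>A. f a [^] p \<otimes> a)"
    using frobenius_generators by blast
  let ?F = "{B. B \<subseteq> A \<and> frobenius_independent B}"
  have fin: "finite ?F" using A by simp
  have empty: "{} \<in> ?F" by (simp add: frobenius_independent_def)
  obtain B where B: "B \<subseteq> A" "frobenius_independent B" and "\<forall>B'\<in>?F. B \<subseteq> B' \<longrightarrow> B = B'"
    using finite_has_maximal2[OF fin empty] by auto
  then have max: "\<And>B'. B' \<subseteq> A \<Longrightarrow> frobenius_independent B' \<Longrightarrow> B \<subseteq> B' \<Longrightarrow> B' = B"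
    by auto
  have B': "finite B" "B \<subseteq> carrier R" using A B(1) finite_subset by auto
  have "\<exists>s\<in>carrier R. s \<noteq> \<zero> \<and> (\<forall>a\<in>A'. s [^] p \<otimes> a \<in> frobenius_span B)" if "finite A'" "A' \<subseteq> A" for A'
    using that
  proof (induction A')
    case empty
    then show ?case by (intro bexI[of _ \<one>]) auto
  next
    case (insert a A')
    then obtain s where s: "s \<in> carrier R" "s \<noteq> \<zero>" "\<forall>a\<in>A'. s [^] p \<otimes> a \<in> frobenius_span B"
      by auto
    obtain t where t: "t \<in> carrier R" "t \<noteq> \<zero>" "t [^] p \<otimes> a \<in> frobenius_span B"
      using dependent_on_maximal_independent[OF A B max, of a] insert.prems by auto
    have "(s \<otimes> t) [^] p \<otimes> a' \<in> frobenius_span B" if "a' \<in> insert a A'" for a'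
    proof -
      have a': "a' \<in> carrier R" using that insert.prems A by auto
      have "(s \<otimes> t) [^] p \<otimes> a' = s [^] p \<otimes> (t [^] p \<otimes> a')"
        "(s \<otimes> t) [^] p \<otimes> a' = t [^] p \<otimes> (s [^] p \<otimes> a')"
        using s t a' by (simp_all add: nat_pow_distrib m_assoc m_lcomm)
      then show ?thesis
        using that s t frobenius_span_smult[OF B'] by (metis insert_iff)
    qed
    moreover have "s \<otimes> t \<noteq> \<zero>" using s t by (simp add: integral_iff)
    ultimately show ?case using s t by blast
  qed
  from this[OF A(1) subset_refl] obtain s where s: "s \<in> carrier R" "s \<noteq> \<zero>"
    and sA: "\<And>a. a \<in> A \<Longrightarrow> s [^] p \<otimes> a \<in> frobenius_span B" by blast
  have span: "s [^] p \<otimes> x \<in> frobenius_span B" if "x \<in> carrier R" for x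
  proof -
    obtain f where f: "f \<in> A \<rightarrow> carrier R" "x = (\<Oplus>a\<in>A. f a [^] p \<otimes> a)"
      using gen \<open>x \<in> carrier R\<close> by blast
    have "s [^] p \<otimes> x = (\<Oplus>a\<in>A. s [^] p \<otimes> (f a [^] p \<otimes> a))"
      unfolding f(2) using A s term_closed[OF A f(1)] by (intro finsum_rdistr) auto
    also have "\<dots> \<in> frobenius_span B"
    proof (rule frobenius_span_finsum[OF B'])
      fix a assume a: "a \<in> A"
      then have "f a \<in> carrier R" "a \<in> carrier R" using f(1) A by auto
      then have "s [^] p \<otimes> (f a [^] p \<otimes> a) = f a [^] p \<otimes> (s [^] p \<otimes> a)"
        using s by (intro m_lcomm) auto
      then show "s [^] p \<otimes> (f a [^] p \<otimes> a) \<in> frobenius_span B"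
        using frobenius_span_smult[OF B' sA[OF a] \<open>f a \<in> carrier R\<close>] by simp
    qed
    finally show ?thesis .
  qed
  have "\<forall>x\<in>carrier R. \<exists>f. f \<in> B \<rightarrow> carrier R \<and> s [^] p \<otimes> x = (\<Oplus>b\<in>B. f b [^] p \<otimes> b)"
    using span unfolding frobenius_span_def by blast
  from bchoice[OF this] obtain \<kappa> where \<kappa>: "\<And>x. x \<in> carrier R \<Longrightarrow> \<kappa> x \<in> B \<rightarrow> carrier R"
    and \<kappa>_sum: "\<And>x. x \<in> carrier R \<Longrightarrow> s [^] p \<otimes> x = (\<Oplus>b\<in>B. \<kappa> x b [^] p \<otimes> b)"
    by auto
  have "(\<lambda>x. \<kappa> x b) \<in> cartier_maps p 1 R (self_module R)" if b: "b \<in> B" for b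
    unfolding cartier_maps_iff
  proof (intro conjI ballI)
    show "(\<lambda>x. \<kappa> x b) \<in> carrier R \<rightarrow> carrier (self_module R)"
      using \<kappa> b by auto
    fix x y assume x: "x \<in> carrier R" and y: "y \<in> carrier R"
    have "\<kappa> (x \<oplus> y) b = \<kappa> x b \<oplus> \<kappa> y b"
    proof (rule frobenius_independentD[OF B' B(2) \<kappa> _ _ b])
      show "(\<lambda>b. \<kappa> x b \<oplus> \<kappa> y b) \<in> B \<rightarrow> carrier R" using \<kappa>[OF x] \<kappa>[OF y] by auto
      show "(\<Oplus>b\<in>B. \<kappa> (x \<oplus> y) b [^] p \<otimes> b) = (\<Oplus>b\<in>B. (\<kappa> x b \<oplus> \<kappa> y b) [^] p \<otimes> b)"
        using x y s by (simp add: frobenius_comb_add[OF B' \<kappa>[OF x] \<kappa>[OF y]] r_distr flip: \<kappa>_sum)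
    qed (use x y in simp)
    then show "\<kappa> (x \<oplus> y) b = \<kappa> x b \<oplus>\<^bsub>self_module R\<^esub> \<kappa> y b" by simp
    have "\<kappa> (y [^] p \<otimes> x) b = y \<otimes> \<kappa> x b"
    proof (rule frobenius_independentD[OF B' B(2) \<kappa> _ _ b])
      show "(\<lambda>b. y \<otimes> \<kappa> x b) \<in> B \<rightarrow> carrier R" using \<kappa>[OF x] y by auto
      have "s [^] p \<otimes> (y [^] p \<otimes> x) = y [^] p \<otimes> (s [^] p \<otimes> x)"
        using x y s by (intro m_lcomm) auto
      then show "(\<Oplus>b\<in>B. \<kappa> (y [^] p \<otimes> x) b [^] p \<otimes> b) = (\<Oplus>b\<in>B. (y \<otimes> \<kappa> x b) [^] p \<otimes> b)"
        using x y s by (simp add: frobenius_comb_smult[OF B' \<kappa>[OF x] y] flip: \<kappa>_sum)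
    qed (use x y in simp)
    then show "\<kappa> (y [^] (p ^ 1) \<otimes> x) b = y \<odot>\<^bsub>self_module R\<^esub> \<kappa> x b" by simp
  qed
  then show thesis
    by (rule that[OF B' s]) (use \<kappa>_sum in auto)
qed

end

section \<open>A determinant-free Nakayama argument\<close>

lemma (in ideal) finsum_mem:
  assumes "\<And>a. a \<in> A \<Longrightarrow> h a \<in> I"
  shows "(\<Oplus>a\<in>A. h a) \<in> I"
  using assms
proof (induction A rule: infinite_finite_induct)
  case (insert a A)
  then have "h \<in> A \<rightarrow> carrier R" "h a \<in> carrier R"
    using Icarr by auto
  with insert show ?case by (simp add: a_closed)
qed auto

lemma (in cring) genideal_insert:
  assumes "A \<subseteq> carrier R" "t \<in> carrier R" "x \<in> Idl (insert t A)"
  obtains r y where "r \<in> carrier R" "y \<in> Idl A" "x = r \<otimes> t \<oplus> y"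
proof -
  have A: "ideal (Idl A) R" by (rule genideal_ideal[OF assms(1)])
  have "Idl (insert t A) \<subseteq> Idl A <+>\<^bsub>R\<^esub> Idl {t}"
    using ideal_add_member[OF A assms(2)] genideal_self[OF assms(1)]
    by (intro genideal_minimal) auto
  then obtain y z where yz: "y \<in> Idl A" "z \<in> Idl {t}" "x = y \<oplus> z"
    using assms(3) unfolding set_add_def' by blast
  then obtain r where "r \<in> carrier R" "z = r \<otimes> t"
    using cgenideal_eq_genideal[OF assms(2)] by (auto simp: cgenideal_def)
  then show thesis
    using yz assms(2) ideal.Icarr[OF A] by (intro that[of r y]) (auto simp: a_comm)
qed

text \<open>This is Nakayama's lemma in the form: an ideal with \<open>qJ \<subseteq> J\<^sup>2\<close> becomes idempotent, hence trivial,
  once \<open>q\<close> is inverted. Instead of a determinant, the generators of \<open>J\<close> are eliminated one at a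
  time. At each stage there is an element \<open>w\<close> congruent to a power of \<open>q\<close> modulo \<open>J\<close> that multiplies
  \<open>J\<close> into the ideal of the remaining generators. At the end \<open>wJ = 0\<close>, so \<open>w = 0\<close>
  because \<open>J\<close> is nonzero and the ring is a domain, and the power of \<open>q\<close> lies in \<open>J\<close>.\<close>

lemma (in noetherian_domain) power_mem_of_mult_into_square:
  assumes J: "ideal J R" "J \<noteq> {\<zero>}" and q: "q \<in> carrier R"
    and square: "\<And>x. x \<in> J \<Longrightarrow> q \<otimes> x \<in> ideal_prod R J J"
  shows "\<exists>k::nat. q [^] k \<in> J"
proof -
  interpret J: ideal J R by (rule J(1))
  define W where "W = {w \<in> carrier R. \<exists>k::nat. q [^] k \<ominus> w \<in> J}"
  have W_mult: "v \<otimes> w \<in> W" if v: "v \<in> W" and w: "w \<in> W" for v w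
  proof -
    from v w obtain k l :: nat where kl: "v \<in> carrier R" "w \<in> carrier R"
      "q [^] k \<ominus> v \<in> J" "q [^] l \<ominus> w \<in> J" by (auto simp: W_def)
    have "q [^] (k + l) \<ominus> v \<otimes> w = q [^] k \<otimes> (q [^] l \<ominus> w) \<oplus> (q [^] k \<ominus> v) \<otimes> w"
    proof -
      have "a \<otimes> b \<ominus> v \<otimes> w = a \<otimes> (b \<ominus> w) \<oplus> (a \<ominus> v) \<otimes> w"
        if "a \<in> carrier R" "b \<in> carrier R" for a b
        using that kl(1,2) by algebra
      from this[of "q [^] k" "q [^] l"] show ?thesis using q by (simp add: nat_pow_mult)
    qed
    also have "\<dots> \<in> J"
      using kl q by (intro J.a_closed J.I_l_closed J.I_r_closed) auto
    finally show ?thesis using kl by (auto simp: W_def)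
  qed
  have W_q: "q \<in> W"
  proof -
    have "q [^] (1::nat) \<ominus> q = \<zero>" using q by (simp add: minus_eq r_neg)
    then show ?thesis using q J.zero_closed unfolding W_def by (metis (mono_tags, lifting) mem_Collect_eq)
  qed
  have W_diff: "w \<ominus> b \<in> W" if "w \<in> W" "b \<in> J" for w b
  proof -
    from that obtain k :: nat where k: "w \<in> carrier R" "q [^] k \<ominus> w \<in> J" by (auto simp: W_def)
    have b: "b \<in> carrier R" using that J.Icarr by blast
    have "a \<ominus> (w \<ominus> b) = (a \<ominus> w) \<oplus> b" if "a \<in> carrier R" for a
      using that k(1) b by algebra
    then have "q [^] k \<ominus> (w \<ominus> b) = (q [^] k \<ominus> w) \<oplus> b" using q by simp
    then have "q [^] k \<ominus> (w \<ominus> b) \<in> J" using J.a_closed[OF k(2) that(2)] by simp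
    then show ?thesis using k(1) b unfolding W_def by blast
  qed
  have elim: "\<exists>w\<in>W. \<forall>x\<in>J. w \<otimes> x = \<zero>"
    if "finite A" "A \<subseteq> J" "\<exists>w\<in>W. \<forall>x\<in>J. w \<otimes> x \<in> Idl A" for A
    using that
  proof (induction A)
    case empty
    have "Idl {} \<subseteq> {\<zero>}" by (intro genideal_minimal zeroideal) auto
    then show ?case using empty by blast
  next
    case (insert t A)
    then obtain w where w: "w \<in> W" and wJ: "\<And>x. x \<in> J \<Longrightarrow> w \<otimes> x \<in> Idl (insert t A)" by blast
    have w': "w \<in> carrier R" using w by (simp add: W_def)
    have t: "t \<in> J" "t \<in> carrier R" and A: "A \<subseteq> carrier R" using insert.prems J.Icarr by auto
    interpret A: ideal "Idl A" R by (rule genideal_ideal[OF A])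
    \<comment> \<open>Multiplying by \<open>w\<close> moves one factor of a product from \<open>J\<close> to the generators; the other
      factor stays in \<open>J\<close> and becomes the coefficient of \<open>t\<close>.\<close>
    have prod: "\<exists>b\<in>J. \<exists>y\<in>Idl A. w \<otimes> z = b \<otimes> t \<oplus> y" if "z \<in> ideal_prod R J J" for z
      using that
    proof (induction z)
      case (prod i j)
      then have ij: "i \<in> carrier R" "j \<in> carrier R" using J.Icarr by auto
      obtain r y where r: "r \<in> carrier R" "y \<in> Idl A" "w \<otimes> i = r \<otimes> t \<oplus> y"
        using genideal_insert[OF A t(2) wJ[OF prod(1)]] by blast
      have y: "y \<in> carrier R" using r A.Icarr by blast
      have "w \<otimes> (i \<otimes> j) = (r \<otimes> t \<oplus> y) \<otimes> j" using w' ij r by (simp flip: m_assoc)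
      also have "\<dots> = (r \<otimes> j) \<otimes> t \<oplus> y \<otimes> j" using ij r(1) y t(2) by algebra
      finally show ?case
        using prod r(1,2) ij J.I_l_closed[of j r] A.I_r_closed[of y j] by blast
    next
      case (sum z1 z2)
      then obtain b1 y1 b2 y2 where *: "b1 \<in> J" "y1 \<in> Idl A" "w \<otimes> z1 = b1 \<otimes> t \<oplus> y1"
        "b2 \<in> J" "y2 \<in> Idl A" "w \<otimes> z2 = b2 \<otimes> t \<oplus> y2" by blast
      have carr: "b1 \<in> carrier R" "b2 \<in> carrier R" "y1 \<in> carrier R" "y2 \<in> carrier R"
        using * J.Icarr A.Icarr by auto
      have z: "z1 \<in> carrier R" "z2 \<in> carrier R"
        using sum.hyps ideal_prod_in_carrier[OF J(1) J(1)] by auto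
      have "w \<otimes> (z1 \<oplus> z2) = (b1 \<otimes> t \<oplus> y1) \<oplus> (b2 \<otimes> t \<oplus> y2)"
        using * z w' by (simp add: r_distr)
      also have "\<dots> = (b1 \<oplus> b2) \<otimes> t \<oplus> (y1 \<oplus> y2)" using carr t(2) by algebra
      finally show ?case using * J.a_closed A.a_closed by blast
    qed
    obtain b y where b: "b \<in> J" "y \<in> Idl A" "w \<otimes> (q \<otimes> t) = b \<otimes> t \<oplus> y"
      using prod[OF square[OF t(1)]] by blast
    have carr: "b \<in> carrier R" "y \<in> carrier R" using b J.Icarr A.Icarr by auto
    \<comment> \<open>The relation \<open>w q t = b t + y\<close> with \<open>b \<in> J\<close> says that \<open>w q - b\<close> moves \<open>t\<close> into the ideal
      of the remaining generators.\<close>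
    define u where "u = w \<otimes> q \<ominus> b"
    have u: "u \<in> W" unfolding u_def by (intro W_diff W_mult w W_q b(1))
    have u': "u \<in> carrier R" using u by (simp add: W_def)
    have "u \<otimes> t = w \<otimes> (q \<otimes> t) \<ominus> b \<otimes> t"
      unfolding u_def using w' q t(2) carr by algebra
    also have "\<dots> = y" unfolding b(3) using carr t(2) by algebra
    finally have ut: "u \<otimes> t \<in> Idl A" using b by simp
    have "(u \<otimes> w) \<otimes> x \<in> Idl A" if x: "x \<in> J" for x
    proof -
      have x': "x \<in> carrier R" using x J.Icarr by blast
      obtain r z where r: "r \<in> carrier R" "z \<in> Idl A" "w \<otimes> x = r \<otimes> t \<oplus> z"
        using genideal_insert[OF A t(2) wJ[OF x]] by blast
      have z: "z \<in> carrier R" using r A.Icarr by blast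
      have "(u \<otimes> w) \<otimes> x = u \<otimes> (r \<otimes> t \<oplus> z)" using u' w' x' r(3) by (simp add: m_assoc)
      also have "\<dots> = r \<otimes> (u \<otimes> t) \<oplus> u \<otimes> z" using r(1) z t(2) u' by algebra
      finally show ?thesis
        using A.a_closed[OF A.I_l_closed[OF ut r(1)] A.I_l_closed[OF r(2) u']] by simp
    qed
    then show ?case
      using insert.IH insert.prems W_mult[OF u w] by blast
  qed
  obtain A where A: "A \<subseteq> carrier R" "finite A" "J = Idl A"
    using finetely_gen[OF J(1)] by blast
  have "\<exists>w\<in>W. \<forall>x\<in>J. w \<otimes> x \<in> Idl A"
    using W_q J.I_l_closed q A(3) by blast
  then obtain w where w: "w \<in> W" "\<And>x. x \<in> J \<Longrightarrow> w \<otimes> x = \<zero>"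
    using elim[OF A(2)] genideal_self[OF A(1)] A(3) by blast
  obtain x where x: "x \<in> J" "x \<noteq> \<zero>" using J(2) J.zero_closed by blast
  have "w = \<zero>"
    using w(2)[OF x(1)] x J.Icarr[OF x(1)] w(1) by (auto simp: W_def integral_iff)
  then obtain k :: nat where "q [^] k \<ominus> \<zero> \<in> J" using w(1) by (auto simp: W_def)
  moreover have "q [^] k \<ominus> \<zero> = q [^] k" using q by (simp add: minus_eq)
  ultimately show ?thesis by auto
qed

section \<open>Test elements\<close>

lemma (in domain) avoiding_minimal_primes_domain: "avoiding_minimal_primes R = carrier R - {\<zero>}"
proof -
  have zero: "{\<zero>} \<subseteq> Q" if "primeideal Q R" for Q
    using additive_subgroup.zero_closed[OF ideal.axioms(1)[OF primeideal.axioms(1)[OF that]]]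
    by simp
  have "minimal_primes R = {{\<zero>}}"
  proof (intro equalityI subsetI)
    fix Q assume "Q \<in> minimal_primes R"
    then have "primeideal Q R" "\<And>Q'. primeideal Q' R \<Longrightarrow> Q' \<subseteq> Q \<Longrightarrow> Q' = Q"
      by (auto simp: minimal_primes_def)
    then show "Q \<in> {{\<zero>}}" using zero zeroprimeideal by blast
  next
    fix Q assume Q: "Q \<in> {{\<zero>}}"
    have "Q' = Q" if "primeideal Q' R" "Q' \<subseteq> Q" for Q'
      using zero[OF that(1)] that(2) Q by auto
    then show "Q \<in> minimal_primes R"
      using zeroprimeideal Q by (auto simp: minimal_primes_def)
  qed
  then show ?thesis by (auto simp: avoiding_minimal_primes_def)
qed

context F_finite_noetherian_domain
begin

sublocale self: module_over R "self_module R"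
  by (rule module_over_self)

text \<open>The ideal of all sums of values \<open>\<phi> d\<close> of Cartier maps \<open>\<phi>\<close> on \<open>R\<close> of level at least \<open>e\<close>.
  An element that lies in all of them for \<open>d \<noteq> 0\<close> is a test element.\<close>

abbreviation test_set :: "'a \<Rightarrow> nat \<Rightarrow> 'a set" where
  "test_set \<equiv> tight_interior_at p R (self_module R)"

lemma test_set_ideal:
  assumes "d \<in> carrier R"
  shows "ideal (test_set d e) R"
proof (rule idealI)
  show "ring R" by (rule ring_axioms)
  show "subgroup (test_set d e) (add_monoid R)"
  proof
    show "test_set d e \<subseteq> carrier (add_monoid R)"
      using self.tight_interior_at_closed assms by auto
    show "\<one>\<^bsub>add_monoid R\<^esub> \<in> test_set d e"
      using self.zero_in_tight_interior_at by simp
    fix x y assume x: "x \<in> test_set d e" and y: "y \<in> test_set d e"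
    show "x \<otimes>\<^bsub>add_monoid R\<^esub> y \<in> test_set d e"
      using self.tight_interior_at_add[OF x y assms] by simp
    have "\<ominus> x = \<ominus> \<one> \<otimes> x"
      using self.tight_interior_at_closed[OF x assms] by (simp add: l_minus)
    then show "inv\<^bsub>add_monoid R\<^esub> x \<in> test_set d e"
      using self.tight_interior_at_smult[OF x assms, of "\<ominus> \<one>"] by (simp add: a_inv_def)
  qed
  fix x a assume x: "x \<in> test_set d e" and a: "a \<in> carrier R"
  show "a \<otimes> x \<in> test_set d e"
    using self.tight_interior_at_smult[OF x assms a] by simp
  then show "x \<otimes> a \<in> test_set d e"
    using self.tight_interior_at_closed[OF x assms] a by (simp add: m_comm)
qed

lemma cartier_map_test_set:
  assumes "x \<in> test_set d e" "\<phi> \<in> cartier_maps p e' R (self_module R)" "d \<in> carrier R"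
  shows "\<phi> x \<in> test_set d (e' + e)" "\<phi> x \<in> test_set d e"
proof -
  show *: "\<phi> x \<in> test_set d (e' + e)"
    by (rule self.cartier_map_tight_interior_at[OF assms])
  show "\<phi> x \<in> test_set d e"
    by (rule self.tight_interior_at_antimono[OF * _ assms(3)]) simp
qed

text \<open>Let \<open>s\<close> be the common denominator of the Cartier coordinates. For \<open>d \<noteq> 0\<close> let \<open>J\<close> be the ideal of
  elements that some power of \<open>s\<close> multiplies into \<open>test_set d e\<close>. It is nonzero and stable under the
  coordinate maps \<open>\<phi>\<^sub>b\<close>, so \<open>s\<^sup>p x = \<Sum> (\<phi>\<^sub>b x)\<^sup>p b\<close> lies in \<open>J\<^sup>2\<close> for every \<open>x\<close> in \<open>J\<close>, and
  Nakayama's lemma puts a power of \<open>s\<close> into \<open>test_set d e\<close>.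

  The exponent still depends on \<open>d\<close> and \<open>e\<close>. Applied to \<open>d = 1\<close>, the same result writes some \<open>s\<^sup>N\<close> as a sum
  of values \<open>g 1\<close> of Cartier maps of positive level. Such a map divides exponents of \<open>s\<close> by at
  least \<open>p \<ge> 2\<close>, so \<open>s\<^sup>k\<close> in \<open>test_set d e\<close> implies that \<open>s\<close> raised to \<open>N + \<lceil>k/2\<rceil>\<close> lies there too.
  This lowers the exponent as long as it exceeds \<open>2N + 1\<close>.\<close>

lemma ex_uniform_test_element:
  "\<exists>c\<in>carrier R. c \<noteq> \<zero> \<and> (\<forall>d\<in>carrier R. d \<noteq> \<zero> \<longrightarrow> (\<forall>e. c \<in> test_set d e))"
proof -
  obtain B s \<phi> where B: "finite B" "B \<subseteq> carrier R" and s: "s \<in> carrier R" "s \<noteq> \<zero>"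
    and \<phi>: "\<And>b. b \<in> B \<Longrightarrow> \<phi> b \<in> cartier_maps p 1 R (self_module R)"
    and coord: "\<And>x. x \<in> carrier R \<Longrightarrow> s [^] p \<otimes> x = (\<Oplus>b\<in>B. \<phi> b x [^] p \<otimes> b)"
    by (rule ex_cartier_coordinates) (rule that)
  have s_pow: "s [^] n \<in> carrier R" "s [^] n \<noteq> \<zero>" for n :: nat
    using s by (induction n) (auto simp: integral_iff)
  have \<phi>_carr: "\<phi> b x \<in> carrier R" if "b \<in> B" "x \<in> carrier R" for b x
    using cartier_mapsD(1)[OF \<phi>] that by simp
  have nonzero: "\<exists>x\<in>test_set d e. x \<noteq> \<zero>" if d: "d \<in> carrier R" "d \<noteq> \<zero>" for d e
  proof (induction e)
    case 0
    have "(\<lambda>x. x) \<in> cartier_maps p 0 R (self_module R)"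
      by (auto simp: cartier_maps_iff)
    from self.tight_interior_at_memI[OF this _ d(1), of 0] show ?case using d by auto
  next
    case (Suc e)
    then obtain x where x: "x \<in> test_set d e" "x \<noteq> \<zero>" by blast
    have x': "x \<in> carrier R" using self.tight_interior_at_closed[OF x(1) d(1)] by simp
    have "\<exists>b\<in>B. \<phi> b x \<noteq> \<zero>"
    proof (rule ccontr)
      assume "\<not> ?thesis"
      then have "(\<Oplus>b\<in>B. \<phi> b x [^] p \<otimes> b) = (\<Oplus>b\<in>B. \<zero>)"
        using B by (intro finsum_cong') auto
      then have "s [^] p \<otimes> x = \<zero>" using coord[OF x'] by simp
      then show False using s_pow x x' by (simp add: integral_iff)
    qed
    then obtain b where b: "b \<in> B" "\<phi> b x \<noteq> \<zero>" by blast
    have "\<phi> b x \<in> test_set d (Suc e)"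
      using cartier_map_test_set(1)[OF x(1) \<phi>[OF b(1)] d(1)] by simp
    then show ?case using b(2) by blast
  qed
  have s_power_mem: "\<exists>n::nat. s [^] n \<in> test_set d e" if d: "d \<in> carrier R" "d \<noteq> \<zero>" for d e
  proof -
    interpret T: ideal "test_set d e" R by (rule test_set_ideal[OF d(1)])
    define J where "J = {x \<in> carrier R. \<exists>n::nat. s [^] n \<otimes> x \<in> test_set d e}"
    have J_I: "x \<in> J" if "x \<in> carrier R" "s [^] n \<otimes> x \<in> test_set d e" for x and n :: nat
      using that by (auto simp: J_def)
    have J: "ideal J R"
    proof (rule idealI)
      show "ring R" by (rule ring_axioms)
      show "subgroup J (add_monoid R)"
      proof
        show "J \<subseteq> carrier (add_monoid R)" by (auto simp: J_def)
        show "\<one>\<^bsub>add_monoid R\<^esub> \<in> J"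
          using T.zero_closed s_pow by (auto simp: J_def)
        fix x y assume x: "x \<in> J" and y: "y \<in> J"
        from x y obtain m n :: nat where mn: "s [^] m \<otimes> x \<in> test_set d e"
          "s [^] n \<otimes> y \<in> test_set d e" and xy: "x \<in> carrier R" "y \<in> carrier R"
          by (auto simp: J_def)
        have "s [^] (m + n) \<otimes> (x \<oplus> y) = s [^] n \<otimes> (s [^] m \<otimes> x) \<oplus> s [^] m \<otimes> (s [^] n \<otimes> y)"
          using xy s by (simp add: r_distr m_ac flip: nat_pow_mult)
        also have "\<dots> \<in> test_set d e"
          using T.a_closed[OF T.I_l_closed[OF mn(1) s_pow(1)] T.I_l_closed[OF mn(2) s_pow(1)]] .
        finally show "x \<otimes>\<^bsub>add_monoid R\<^esub> y \<in> J" using J_I[of "x \<oplus> y" "m + n"] xy by simp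
        have "s [^] m \<otimes> (\<ominus> x) = \<ominus> (s [^] m \<otimes> x)" using xy s by (simp add: r_minus)
        also have "\<dots> \<in> test_set d e" using mn by simp
        finally show "inv\<^bsub>add_monoid R\<^esub> x \<in> J"
          using J_I[of "\<ominus> x" m] xy by (simp add: a_inv_def)
      qed
      fix x a assume "x \<in> J" and a: "a \<in> carrier R"
      then obtain n :: nat where n: "s [^] n \<otimes> x \<in> test_set d e" and x: "x \<in> carrier R"
        by (auto simp: J_def)
      have "s [^] n \<otimes> (a \<otimes> x) = a \<otimes> (s [^] n \<otimes> x)" using a x s by (intro m_lcomm) auto
      then show "a \<otimes> x \<in> J" using J_I[of "a \<otimes> x" n] T.I_l_closed[OF n a] a x by simp
      then show "x \<otimes> a \<in> J" using a x by (simp add: m_comm)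
    qed
    interpret J: ideal J R by (rule J)
    obtain x where x: "x \<in> test_set d e" "x \<noteq> \<zero>" using nonzero[OF d] by blast
    have "s [^] (0::nat) \<otimes> x \<in> test_set d e" using x T.Icarr by simp
    then have "x \<in> J" using x T.Icarr unfolding J_def by blast
    then have J0: "J \<noteq> {\<zero>}" using x by blast
    have \<phi>J: "\<phi> b x \<in> J" if b: "b \<in> B" and xJ: "x \<in> J" for b x
    proof -
      obtain n :: nat where n: "s [^] n \<otimes> x \<in> test_set d e" and x: "x \<in> carrier R"
        using xJ unfolding J_def mem_Collect_eq by (elim conjE exE)
      obtain m where p: "p = Suc (Suc m)" by (rule prime_cases)
      have "(s [^] n) [^] p \<otimes> x = (s [^] n) [^] Suc m \<otimes> (s [^] n \<otimes> x)"
        using x s_pow by (simp add: p m_assoc)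
      also have "\<dots> \<in> test_set d e" using T.I_l_closed[OF n, of "(s [^] n) [^] Suc m"] s_pow by simp
      finally have "\<phi> b ((s [^] n) [^] p \<otimes> x) \<in> test_set d e"
        by (rule cartier_map_test_set(2)[OF _ \<phi>[OF b] d(1)])
      then have "s [^] n \<otimes> \<phi> b x \<in> test_set d e"
        using cartier_mapsD(3)[OF \<phi>[OF b], of "s [^] n" x] x s_pow by simp
      then show ?thesis using \<phi>_carr[OF b x] unfolding J_def by blast
    qed
    have "s [^] p \<otimes> x \<in> ideal_prod R J J" if xJ: "x \<in> J" for x
    proof -
      have x: "x \<in> carrier R" using xJ J.Icarr by blast
      interpret JJ: ideal "ideal_prod R J J" R by (rule ideal_prod_is_ideal[OF J J])
      have "(\<Oplus>b\<in>B. \<phi> b x [^] p \<otimes> b) \<in> ideal_prod R J J"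
      proof (rule JJ.finsum_mem)
        fix b assume b: "b \<in> B"
        have carr: "\<phi> b x \<in> carrier R" "b \<in> carrier R" using \<phi>_carr b x B by auto
        obtain m where p: "p = Suc (Suc m)" by (rule prime_cases)
        have "\<phi> b x [^] p \<otimes> b = (\<phi> b x \<otimes> \<phi> b x) \<otimes> (\<phi> b x [^] m \<otimes> b)"
          using carr by (simp add: p m_ac)
        also have "\<dots> \<in> ideal_prod R J J"
          using carr \<phi>J[OF b xJ] by (intro JJ.I_r_closed ideal_prod.prod) auto
        finally show "\<phi> b x [^] p \<otimes> b \<in> ideal_prod R J J" .
      qed
      then show ?thesis using coord[OF x] by simp
    qed
    then obtain k :: nat where "(s [^] p) [^] k \<in> J"
      using power_mem_of_mult_into_square[OF J J0 s_pow(1)] by blast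
    then obtain n :: nat where "s [^] n \<otimes> (s [^] p) [^] k \<in> test_set d e"
      unfolding J_def mem_Collect_eq by (elim conjE exE)
    then have "s [^] (n + p * k) \<in> test_set d e" using s by (simp add: nat_pow_pow nat_pow_mult)
    then show ?thesis by blast
  qed
  obtain N :: nat where N: "s [^] N \<in> test_set \<one> 1"
    using s_power_mem[of \<one> 1] by auto
  have "s [^] (2 * N + 1) \<in> test_set d e" if d: "d \<in> carrier R" "d \<noteq> \<zero>" for d e
  proof -
    interpret T: ideal "test_set d e" R by (rule test_set_ideal[OF d(1)])
    have up: "s [^] n \<in> test_set d e" if "s [^] m \<in> test_set d e" "m \<le> n" for m n :: nat
    proof -
      have "s [^] n = s [^] (n - m) \<otimes> s [^] m" using s that by (simp add: nat_pow_mult)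
      then show ?thesis using T.I_l_closed[OF that(1) s_pow(1)] by simp
    qed
    define k where "k = (LEAST n::nat. s [^] n \<in> test_set d e)"
    have k: "s [^] k \<in> test_set d e"
      unfolding k_def using s_power_mem[OF d] by (rule LeastI_ex)
    \<comment> \<open>A least exponent above \<open>2N + 1\<close> could be lowered to \<open>t + N\<close>, where \<open>t\<close> is \<open>k/2\<close>
      rounded up.\<close>
    have "k \<le> 2 * N + 1"
    proof (rule ccontr)
      assume big: "\<not> k \<le> 2 * N + 1"
      define t where "t = (k + 1) div 2"
      let ?U = "{x \<in> carrier R. s [^] t \<otimes> x \<in> test_set d e}"
      have "s [^] N \<in> ?U"
      proof (rule self.tight_interior_at_least[OF N])
        fix j g assume j: "1 \<le> j" and g: "g \<in> cartier_maps p j R (self_module R)"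
        have g1: "g \<one> \<in> carrier R" using cartier_mapsD(1)[OF g] by simp
        have "2 \<le> p ^ j"
          using prime_ge_2_nat[OF prime_p] j self_le_power[of p j] by linarith
        then have "t * 2 \<le> t * p ^ j" by (intro mult_le_mono2)
        moreover have "k \<le> t * 2" unfolding t_def by linarith
        ultimately have "s [^] (t * p ^ j) \<in> test_set d e" by (intro up[OF k]) linarith
        then have "g ((s [^] t) [^] (p ^ j) \<otimes> \<one>) \<in> test_set d e"
          using cartier_map_test_set(2)[OF _ g d(1)] s by (simp add: nat_pow_pow)
        then show "g \<one> \<in> ?U"
          using cartier_mapsD(3)[OF g, of "s [^] t" \<one>] s_pow g1 by simp
      qed (use s_pow T.zero_closed in \<open>auto simp: r_distr T.a_closed\<close>)
      then have "s [^] (t + N) \<in> test_set d e" using s by (simp add: nat_pow_mult)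
      then have "k \<le> t + N" unfolding k_def by (rule Least_le)
      then show False using big unfolding t_def by linarith
    qed
    then show ?thesis by (rule up[OF k])
  qed
  then show ?thesis using s_pow by blast
qed

text \<open>A Cartier map sends the test element \<open>c\<close>, which is a sum of values at \<open>d\<close> of maps of arbitrarily high
  level, to a sum of values at \<open>d\<close> of the same kind. A single \<open>c\<close> thus computes the tight interior
  of every module, which turns an infinite intersection into one term.\<close>

theorem ex_test_element:
  obtains c where "c \<in> carrier R" "c \<noteq> \<zero>"
    "\<And>M :: ('a, 'c) module. module R M \<Longrightarrow> tight_interior_at p R M c 0 \<subseteq> tight_interior p R M"
proof -
  obtain c where c: "c \<in> carrier R" "c \<noteq> \<zero>"
    and test: "\<And>d e. d \<in> carrier R \<Longrightarrow> d \<noteq> \<zero> \<Longrightarrow> c \<in> test_set d e"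
    using ex_uniform_test_element by blast
  have "tight_interior_at p R M c 0 \<subseteq> tight_interior p R M" if "module R M"
    for M :: "('a, 'c) module"
  proof
    interpret M: module_over R M using that by (simp add: module_over_def)
    fix z assume z: "z \<in> tight_interior_at p R M c 0"
    have "z \<in> tight_interior_at p R M d e" if d: "d \<in> avoiding_minimal_primes R" for d e
    proof (rule M.tight_interior_at_least[OF z])
      have d': "d \<in> carrier R" "d \<noteq> \<zero>"
        using d by (auto simp: avoiding_minimal_primes_domain)
      show "tight_interior_at p R M d e \<subseteq> carrier M"
        using M.tight_interior_at_closed d'(1) by blast
      show "\<zero>\<^bsub>M\<^esub> \<in> tight_interior_at p R M d e" by (rule M.zero_in_tight_interior_at)
      show "x \<oplus>\<^bsub>M\<^esub> y \<in> tight_interior_at p R M d e"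
        if "x \<in> tight_interior_at p R M d e" "y \<in> tight_interior_at p R M d e" for x y
        by (rule M.tight_interior_at_add[OF that d'(1)])
      fix e' g assume g: "g \<in> cartier_maps p e' R M"
      show "g c \<in> tight_interior_at p R M d e"
        using M.cartier_map_tight_interior_at[OF test[OF d', of e] g d'(1)]
        by (rule M.tight_interior_at_antimono) (use d' in auto)
    qed
    then show "z \<in> tight_interior p R M" by (simp add: tight_interior_def)
  qed
  with c show thesis by (rule that)
qed

end

section \<open>Passing to the quotient by a minimal prime\<close>

text \<open>The image of a finite generating set of the preimage of \<open>J\<close> generates \<open>J\<close>.\<close>

lemma (in ring_hom_ring) noetherian_image:
  assumes "noetherian_ring R" and surj: "h ` carrier R = carrier S"
  shows "noetherian_ring S"
proof (rule S.noetherian_ringI)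
  interpret noetherian_ring R by fact
  fix J assume J: "ideal J S"
  obtain A where A: "A \<subseteq> carrier R" "finite A" and gen: "{r \<in> carrier R. h r \<in> J} = Idl A"
    using finetely_gen[OF ideal_vimage[OF J]] by blast
  have hA: "h ` A \<subseteq> carrier S" using A(1) by auto
  have "h ` A \<subseteq> J" using R.genideal_self[OF A(1)] gen by blast
  then have sub: "Idl\<^bsub>S\<^esub> (h ` A) \<subseteq> J" by (rule S.genideal_minimal[OF J])
  have "A \<subseteq> {r \<in> carrier R. h r \<in> Idl\<^bsub>S\<^esub> (h ` A)}"
    using A(1) S.genideal_self[OF hA] by blast
  then have "Idl A \<subseteq> {r \<in> carrier R. h r \<in> Idl\<^bsub>S\<^esub> (h ` A)}"
    by (rule R.genideal_minimal[OF ideal_vimage[OF S.genideal_ideal[OF hA]]])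
  then have lift: "h r \<in> Idl\<^bsub>S\<^esub> (h ` A)" if "r \<in> carrier R" "h r \<in> J" for r
    using gen that by blast
  have "x \<in> Idl\<^bsub>S\<^esub> (h ` A)" if x: "x \<in> J" for x
  proof -
    obtain r where "r \<in> carrier R" "x = h r"
      using ideal.Icarr[OF J x] surj by blast
    then show ?thesis using lift x by blast
  qed
  with sub have "J = Idl\<^bsub>S\<^esub> (h ` A)" by blast
  then show "\<exists>A\<subseteq>carrier S. finite A \<and> J = Idl\<^bsub>S\<^esub> A"
    using hA A(2) by blast
qed

lemma (in ideal) quotient_carrier: "carrier (R Quot I) = (+>) I ` carrier R"
  by (auto simp: FactRing_def A_RCOSETS_def')

lemma (in ideal) rcos_eq_iff:
  assumes "x \<in> carrier R" "y \<in> carrier R"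
  shows "I +> x = I +> y \<longleftrightarrow> x \<ominus> y \<in> I"
  using quotient_eq_iff_same_a_r_cos[OF is_ideal assms] by auto

lemma (in ideal) rcos_eq_zero_iff:
  assumes "x \<in> carrier R"
  shows "I +> x = \<zero>\<^bsub>R Quot I\<^esub> \<longleftrightarrow> x \<in> I"
proof -
  have "I +> \<zero> = \<zero>\<^bsub>R Quot I\<^esub>" by (simp add: FactRing_def a_rcos_zero is_ideal)
  moreover have "x \<ominus> \<zero> = x" using assms by (simp add: minus_eq)
  ultimately show ?thesis using rcos_eq_iff[OF assms zero_closed] by simp
qed

lemma (in noetherian_cring) nilradical_eq_Inter:
  "nilradical R = {x \<in> carrier R. \<forall>P\<in>minimal_primes R. x \<in> P}"
proof -
  obtain k :: nat where k: "\<forall>x\<in>carrier R. (\<forall>P\<in>minimal_primes R. x \<in> P) \<longrightarrow> x [^] k = \<zero>"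
    using intersection_minimal_primes_nilpotent by blast
  have "x \<in> P" if x: "x \<in> carrier R" "x [^] n = \<zero>" and P: "P \<in> minimal_primes R" for x P and n :: nat
  proof -
    interpret P: primeideal P R using P by (simp add: minimal_primes_def)
    show ?thesis using P.pow_mem[OF x(1), of n] x(2) by simp
  qed
  with k show ?thesis by (auto simp: nilradical_def)
qed

lemma (in noetherian_cring) nilradical_ideal:
  assumes "minimal_primes R \<noteq> {}"
  shows "ideal (nilradical R) R"
proof -
  have ideal: "ideal P R" if "P \<in> minimal_primes R" for P
    using that primeideal.axioms(1) by (auto simp: minimal_primes_def)
  have "nilradical R = \<Inter> (minimal_primes R)"
    using assms ideal.Icarr[OF ideal] unfolding nilradical_eq_Inter by blast
  then show ?thesis using i_Intersect[OF ideal assms] by simp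
qed

lemma F_finite_generators:
  assumes "F_finite p S"
  shows "\<exists>A. finite A \<and> A \<subseteq> carrier S \<and>
    (\<forall>x\<in>carrier S. \<exists>f\<in>A \<rightarrow> carrier S. x = (\<Oplus>\<^bsub>S\<^esub>a\<in>A. f a [^]\<^bsub>S\<^esub> p \<otimes>\<^bsub>S\<^esub> a))"
proof -
  let ?N = "restrict_scalars (frobenius p S) (self_module S)"
  have N: "finsum ?N g A = finsum S g A" for g and A :: "'a set"
    by (simp add: finsum_def finprod_def restrict_scalars_def self_module_def)
  obtain A where A: "finite A" "A \<subseteq> carrier ?N"
    and gen: "carrier ?N = {(\<Oplus>\<^bsub>?N\<^esub>a\<in>A. f a \<odot>\<^bsub>?N\<^esub> a) | f. f \<in> A \<rightarrow> carrier S}"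
    using assms unfolding F_finite_def finite_ring_hom_def finitely_generated_module_def by blast
  have carr: "carrier ?N = carrier S" by (simp add: restrict_scalars_def)
  have smult: "a \<odot>\<^bsub>?N\<^esub> b = a [^]\<^bsub>S\<^esub> p \<otimes>\<^bsub>S\<^esub> b" for a b
    by (simp add: restrict_scalars_def frobenius_def)
  have "\<exists>f\<in>A \<rightarrow> carrier S. x = (\<Oplus>\<^bsub>S\<^esub>a\<in>A. f a [^]\<^bsub>S\<^esub> p \<otimes>\<^bsub>S\<^esub> a)" if "x \<in> carrier S" for x
    using that gen unfolding carr N smult by blast
  then show ?thesis using A carr by blast
qed

lemma (in prime_char_cring) frobenius_span_image:
  assumes "finite A" "h \<in> A \<rightarrow> carrier R" "f \<in> A \<rightarrow> carrier R"
  shows "(\<Oplus>a\<in>A. f a [^] p \<otimes> h a) \<in> frobenius_span (h ` A)"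
proof -
  have hA: "finite (h ` A)" "h ` A \<subseteq> carrier R" using assms(1,2) by auto
  show ?thesis
    using assms(3) by (intro frobenius_span_finsum[OF hA] frobenius_span_smult[OF hA]
        frobenius_span_base[OF hA]) auto
qed

lemma quotient_prime_char_cring:
  fixes R (structure)
  assumes "prime_char_cring R p" "ideal I R"
  shows "prime_char_cring (R Quot I) p"
proof -
  interpret prime_char_cring R p by fact
  interpret I: ideal I R by fact
  interpret pi: ring_hom_cring R "R Quot I" "(+>) I" by (rule I.rcos_ring_hom_cring[OF is_cring])
  have "[n] \<cdot>\<^bsub>R Quot I\<^esub> (I +> \<one>) = I +> ([n] \<cdot> \<one>)" for n :: nat
    by (induction n) auto
  then have "[p] \<cdot>\<^bsub>R Quot I\<^esub> \<one>\<^bsub>R Quot I\<^esub> = \<zero>\<^bsub>R Quot I\<^esub>"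
    using char_p pi.hom_one pi.hom_zero by metis
  then show ?thesis
    by (intro prime_char_cring.intro prime_char_cring_axioms.intro prime_p pi.S.is_cring)
qed

text \<open>Every minimal prime contains the nilradical, so the Frobenius generators of \<open>R\<^sub>r\<^sub>e\<^sub>d\<close> map to
  Frobenius generators of its quotient \<open>R/P\<close>. The map is realised by lifting generators and coefficients
  to \<open>R\<close>.\<close>

lemma quotient_F_finite_noetherian_domain:
  fixes R (structure)
  assumes "noetherian_cring R" "prime_char_cring R p" "F_finite p (reduced_ring R)"
    and P: "P \<in> minimal_primes R"
  shows "F_finite_noetherian_domain (R Quot P) p"
proof -
  interpret noetherian_cring R by fact
  interpret prime_char_cring R p by fact
  interpret P: primeideal P R using P by (simp add: minimal_primes_def)
  interpret N: ideal "nilradical R" R using nilradical_ideal P by blast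
  interpret pi: ring_hom_cring R "R Quot P" "(+>) P" by (rule P.rcos_ring_hom_cring)
  interpret nu: ring_hom_cring R "R Quot nilradical R" "(+>) (nilradical R)"
    by (rule N.rcos_ring_hom_cring[OF is_cring])
  have noeth: "noetherian_ring (R Quot P)"
    using pi.ring.noetherian_image noetherian_ring_axioms P.quotient_carrier by simp
  have pc: "prime_char_cring (R Quot P) p"
    by (rule quotient_prime_char_cring[OF assms(2) P.is_ideal])
  obtain A where A: "finite A" "A \<subseteq> carrier (R Quot nilradical R)"
    and gen: "\<forall>x\<in>carrier (R Quot nilradical R). \<exists>f\<in>A \<rightarrow> carrier (R Quot nilradical R).
      x = (\<Oplus>\<^bsub>R Quot nilradical R\<^esub>a\<in>A. f a [^]\<^bsub>R Quot nilradical R\<^esub> p \<otimes>\<^bsub>R Quot nilradical R\<^esub> a)"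
    using F_finite_generators[OF assms(3)] unfolding reduced_ring_def by (elim exE conjE)
  have "\<forall>Z\<in>carrier (R Quot nilradical R). \<exists>r. r \<in> carrier R \<and> nilradical R +> r = Z"
    unfolding N.quotient_carrier by blast
  from bchoice[OF this] obtain \<rho> where
    \<rho>: "\<And>Z. Z \<in> carrier (R Quot nilradical R) \<Longrightarrow> \<rho> Z \<in> carrier R"
      "\<And>Z. Z \<in> carrier (R Quot nilradical R) \<Longrightarrow> nilradical R +> \<rho> Z = Z" by blast
  let ?A = "(\<lambda>a. P +> \<rho> a) ` A"
  have A': "finite ?A" "?A \<subseteq> carrier (R Quot P)"
    using A \<rho>(1) by (auto intro!: pi.hom_closed)
  have span: "Z \<in> prime_char_cring.frobenius_span (R Quot P) p ?A" if Z: "Z \<in> carrier (R Quot P)" for Z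
  proof -
    obtain x where x: "x \<in> carrier R" "Z = P +> x"
      using Z unfolding P.quotient_carrier by blast
    obtain f where f: "f \<in> A \<rightarrow> carrier (R Quot nilradical R)"
      and xf: "nilradical R +> x = (\<Oplus>\<^bsub>R Quot nilradical R\<^esub>a\<in>A.
        f a [^]\<^bsub>R Quot nilradical R\<^esub> p \<otimes>\<^bsub>R Quot nilradical R\<^esub> a)"
      using bspec[OF gen nu.hom_closed[OF x(1)]] by (elim bexE)
    define g where "g a = \<rho> (f a) [^] p \<otimes> \<rho> a" for a
    have carr: "\<rho> (f a) \<in> carrier R" "\<rho> a \<in> carrier R" if "a \<in> A" for a
      using \<rho>(1) f A(2) that by auto
    have g: "g \<in> A \<rightarrow> carrier R" unfolding g_def using carr by auto
    have "nilradical R +> (\<Oplus>a\<in>A. g a) = (\<Oplus>\<^bsub>R Quot nilradical R\<^esub>a\<in>A. nilradical R +> g a)"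
      using nu.hom_finsum[OF g] by (simp add: comp_def)
    also have "\<dots> = nilradical R +> x"
      unfolding xf
    proof (rule nu.S.finsum_cong')
      fix a assume a: "a \<in> A"
      then have "f a \<in> carrier (R Quot nilradical R)" "a \<in> carrier (R Quot nilradical R)"
        using f A(2) by auto
      then show "nilradical R +> g a =
          f a [^]\<^bsub>R Quot nilradical R\<^esub> p \<otimes>\<^bsub>R Quot nilradical R\<^esub> a"
        unfolding g_def using carr[OF a] \<rho>(2) by (simp add: nu.ring.hom_nat_pow)
    qed (use f A in auto)
    finally have "nilradical R +> x = nilradical R +> (\<Oplus>a\<in>A. g a)" by (rule sym)
    then have "x \<ominus> (\<Oplus>a\<in>A. g a) \<in> nilradical R"
      by (rule iffD1[OF N.rcos_eq_iff[OF x(1) finsum_closed[OF g]]])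
    then have "x \<ominus> (\<Oplus>a\<in>A. g a) \<in> P" using P unfolding nilradical_eq_Inter by blast
    then have "Z = P +> (\<Oplus>a\<in>A. g a)"
      unfolding x(2) by (rule iffD2[OF P.rcos_eq_iff[OF x(1) finsum_closed[OF g]]])
    also have "\<dots> = (\<Oplus>\<^bsub>R Quot P\<^esub>a\<in>A. P +> g a)"
      using pi.hom_finsum[OF g] by (simp add: comp_def)
    also have "\<dots> = (\<Oplus>\<^bsub>R Quot P\<^esub>a\<in>A. (P +> \<rho> (f a)) [^]\<^bsub>R Quot P\<^esub> p \<otimes>\<^bsub>R Quot P\<^esub> (P +> \<rho> a))"
    proof (rule pi.S.finsum_cong')
      fix a assume a: "a \<in> A"
      show "P +> g a = (P +> \<rho> (f a)) [^]\<^bsub>R Quot P\<^esub> p \<otimes>\<^bsub>R Quot P\<^esub> (P +> \<rho> a)"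
        unfolding g_def using carr[OF a] by (simp add: pi.ring.hom_nat_pow)
    qed (use carr in auto)
    also have "\<dots> \<in> prime_char_cring.frobenius_span (R Quot P) p ?A"
      using carr by (intro prime_char_cring.frobenius_span_image[OF pc A(1)]) auto
    finally show ?thesis .
  qed
  show ?thesis
  proof (intro F_finite_noetherian_domain.intro noetherian_domain.intro
      F_finite_noetherian_domain_axioms.intro)
    show "\<exists>A. finite A \<and> A \<subseteq> carrier (R Quot P) \<and> (\<forall>x\<in>carrier (R Quot P).
      \<exists>f\<in>A \<rightarrow> carrier (R Quot P).
        x = (\<Oplus>\<^bsub>R Quot P\<^esub>a\<in>A. f a [^]\<^bsub>R Quot P\<^esub> p \<otimes>\<^bsub>R Quot P\<^esub> a))"
    proof (intro exI[of _ ?A] conjI ballI A')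
      fix Z assume "Z \<in> carrier (R Quot P)"
      from span[OF this] show "\<exists>f\<in>?A \<rightarrow> carrier (R Quot P).
          Z = (\<Oplus>\<^bsub>R Quot P\<^esub>a\<in>?A. f a [^]\<^bsub>R Quot P\<^esub> p \<otimes>\<^bsub>R Quot P\<^esub> a)"
        unfolding prime_char_cring.frobenius_span_def[OF pc] mem_Collect_eq by (elim exE conjE) (rule bexI)
    qed
  qed (rule noeth P.quotient_is_domain pc)+
qed

context module_over
begin

lemma annihilated_elements_submodule:
  shows "m \<in> annihilated_elements M I \<Longrightarrow> m \<in> carrier M"
    and "m \<in> annihilated_elements M I \<Longrightarrow> a \<in> I \<Longrightarrow> a \<odot>\<^bsub>M\<^esub> m = \<zero>\<^bsub>M\<^esub>"
  by (auto simp: annihilated_elements_def)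

lemma annihilated_module_simps [simp]:
  "carrier (annihilated_module M I) = annihilated_elements M I"
  "x \<oplus>\<^bsub>annihilated_module M I\<^esub> y = x \<oplus>\<^bsub>M\<^esub> y"
  "\<zero>\<^bsub>annihilated_module M I\<^esub> = \<zero>\<^bsub>M\<^esub>"
  by (simp_all add: annihilated_module_def)

lemma annihilated_module_over:
  assumes I: "ideal I R"
  shows "module_over (R Quot I) (annihilated_module M I)"
proof -
  interpret I: ideal I R by fact
  interpret pi: ring_hom_cring R "R Quot I" "(+>) I" by (rule I.rcos_ring_hom_cring[OF R.is_cring])
  have smult: "(I +> r) \<odot>\<^bsub>annihilated_module M I\<^esub> m = r \<odot>\<^bsub>M\<^esub> m"
    if "r \<in> carrier R" "m \<in> annihilated_elements M I" for r m
    by (rule annihilated_module_smult[OF module_axioms I that])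
  have closed: "r \<odot>\<^bsub>M\<^esub> m \<in> annihilated_elements M I" "m \<oplus>\<^bsub>M\<^esub> n \<in> annihilated_elements M I"
    if "r \<in> carrier R" "m \<in> annihilated_elements M I" "n \<in> annihilated_elements M I" for r m n
  proof -
    have "a \<odot>\<^bsub>M\<^esub> (r \<odot>\<^bsub>M\<^esub> m) = \<zero>\<^bsub>M\<^esub>" if a: "a \<in> I" for a
    proof -
      have "a \<odot>\<^bsub>M\<^esub> (r \<odot>\<^bsub>M\<^esub> m) = (a \<otimes> r) \<odot>\<^bsub>M\<^esub> m"
        using \<open>r \<in> _\<close> \<open>m \<in> _\<close> a I.Icarr by (simp add: smult_assoc1 annihilated_elements_def)
      then show ?thesis
        using \<open>m \<in> _\<close> I.I_r_closed[OF a \<open>r \<in> _\<close>] by (simp add: annihilated_elements_def)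
    qed
    then show "r \<odot>\<^bsub>M\<^esub> m \<in> annihilated_elements M I"
      using that by (simp add: annihilated_elements_def)
    show "m \<oplus>\<^bsub>M\<^esub> n \<in> annihilated_elements M I"
      using that I.Icarr by (simp add: annihilated_elements_def smult_r_distr)
  qed
  have "abelian_group (annihilated_module M I)"
  proof (rule abelian_groupI)
    fix x assume "x \<in> carrier (annihilated_module M I)"
    then have x: "x \<in> annihilated_elements M I" by simp
    have "\<ominus>\<^bsub>M\<^esub> x \<in> annihilated_elements M I"
      using closed(1)[OF _ x x, of "\<ominus> \<one>"] x
      by (simp add: annihilated_elements_def smult_l_minus)
    then show "\<exists>y\<in>carrier (annihilated_module M I).
        y \<oplus>\<^bsub>annihilated_module M I\<^esub> x = \<zero>\<^bsub>annihilated_module M I\<^esub>"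
      using x by (intro bexI[of _ "\<ominus>\<^bsub>M\<^esub> x"]) (auto simp: annihilated_elements_def M.l_neg)
  next
    show "\<zero>\<^bsub>annihilated_module M I\<^esub> \<in> carrier (annihilated_module M I)"
      using I.Icarr by (simp add: annihilated_elements_def)
  qed (use closed(2)[OF R.one_closed] in
      \<open>auto simp: M.a_ac annihilated_elements_submodule(1)\<close>)
  moreover have "cring (R Quot I)" by (rule pi.S.is_cring)
  ultimately show ?thesis
    unfolding module_over_def
  proof (intro moduleI)
    fix Z Z' m n
    assume "Z \<in> carrier (R Quot I)" "Z' \<in> carrier (R Quot I)"
      and "m \<in> carrier (annihilated_module M I)" "n \<in> carrier (annihilated_module M I)"
    then obtain r s where rs: "r \<in> carrier R" "Z = I +> r" "s \<in> carrier R" "Z' = I +> s"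
      and m: "m \<in> annihilated_elements M I" and n: "n \<in> annihilated_elements M I"
      unfolding I.quotient_carrier by auto
    have carr: "m \<in> carrier M" "n \<in> carrier M"
      using m n by (simp_all add: annihilated_elements_def)
    note simps = rs(1,3) m n carr smult closed
    show "Z \<odot>\<^bsub>annihilated_module M I\<^esub> m \<in> carrier (annihilated_module M I)"
      unfolding rs(2) using simps by simp
    show "(Z \<oplus>\<^bsub>R Quot I\<^esub> Z') \<odot>\<^bsub>annihilated_module M I\<^esub> m =
      Z \<odot>\<^bsub>annihilated_module M I\<^esub> m \<oplus>\<^bsub>annihilated_module M I\<^esub> Z' \<odot>\<^bsub>annihilated_module M I\<^esub> m"
      unfolding rs(2,4) using simps smult[of "r \<oplus> s" m] by (simp add: smult_l_distr)
    show "Z \<odot>\<^bsub>annihilated_module M I\<^esub> (m \<oplus>\<^bsub>annihilated_module M I\<^esub> n) =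
      Z \<odot>\<^bsub>annihilated_module M I\<^esub> m \<oplus>\<^bsub>annihilated_module M I\<^esub> Z \<odot>\<^bsub>annihilated_module M I\<^esub> n"
      unfolding rs(2) using simps by (simp add: smult_r_distr)
    show "(Z \<otimes>\<^bsub>R Quot I\<^esub> Z') \<odot>\<^bsub>annihilated_module M I\<^esub> m =
      Z \<odot>\<^bsub>annihilated_module M I\<^esub> (Z' \<odot>\<^bsub>annihilated_module M I\<^esub> m)"
      unfolding rs(2,4) using simps smult[of "r \<otimes> s" m] by (simp add: smult_assoc1)
  next
    fix m assume "m \<in> carrier (annihilated_module M I)"
    then show "\<one>\<^bsub>R Quot I\<^esub> \<odot>\<^bsub>annihilated_module M I\<^esub> m = m"
      using smult[of \<one> m] annihilated_elements_submodule(1) by simp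
  qed
qed

text \<open>Composition with the projection \<open>R \<rightarrow> R/I\<close> and the inclusion of \<open>(0 :\<^sub>M I)\<close> into \<open>M\<close>.\<close>

lemma inflate_cartier_map:
  assumes I: "ideal I R" and g: "g \<in> cartier_maps p e (R Quot I) (annihilated_module M I)"
  shows "(\<lambda>x. g (I +> x)) \<in> cartier_maps p e R M"
proof -
  interpret I: ideal I R by fact
  interpret pi: ring_hom_cring R "R Quot I" "(+>) I" by (rule I.rcos_ring_hom_cring[OF R.is_cring])
  have g_closed: "g (I +> x) \<in> annihilated_elements M I" if "x \<in> carrier R" for x
    using cartier_mapsD(1)[OF g pi.hom_closed[OF that]] by simp
  have "g (I +> (r [^] (p ^ e) \<otimes> x)) = r \<odot>\<^bsub>M\<^esub> g (I +> x)"
    if r: "r \<in> carrier R" and x: "x \<in> carrier R" for r x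
    using cartier_mapsD(3)[OF g pi.hom_closed[OF r] pi.hom_closed[OF x]]
      annihilated_module_smult[OF module_axioms I r g_closed[OF x]] r x
    by (simp add: pi.ring.hom_nat_pow)
  moreover have "g (I +> (x \<oplus> y)) = g (I +> x) \<oplus>\<^bsub>M\<^esub> g (I +> y)"
    if x: "x \<in> carrier R" and y: "y \<in> carrier R" for x y
    using cartier_mapsD(2)[OF g pi.hom_closed[OF x] pi.hom_closed[OF y]] x y by simp
  ultimately show ?thesis
    using annihilated_elements_submodule(1)[OF g_closed] unfolding cartier_maps_iff by auto
qed

text \<open>Conversely, a Cartier map that vanishes on \<open>I\<close> factors through \<open>R/I\<close>, and its values are
  automatically killed by \<open>I\<close>: for \<open>a \<in> I\<close> the value \<open>a h x\<close> equals \<open>h (a\<^sup>q x)\<close> with \<open>q = p\<^sup>e\<close>, and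
  \<open>a\<^sup>q\<close> is in \<open>I\<close>.\<close>

lemma deflate_cartier_map:
  assumes I: "ideal I R" and h: "h \<in> cartier_maps p e R M"
    and kill: "\<And>a x. a \<in> I \<Longrightarrow> x \<in> carrier R \<Longrightarrow> h (a \<otimes> x) = \<zero>\<^bsub>M\<^esub>"
    and "0 < p"
  shows "\<exists>g\<in>cartier_maps p e (R Quot I) (annihilated_module M I). \<forall>x\<in>carrier R. g (I +> x) = h x"
proof -
  interpret I: ideal I R by fact
  interpret pi: ring_hom_cring R "R Quot I" "(+>) I" by (rule I.rcos_ring_hom_cring[OF R.is_cring])
  define g where "g Z = the_elem (h ` Z)" for Z
  have g: "g (I +> x) = h x" if x: "x \<in> carrier R" for x
  proof -
    have "h y = h x" if y: "y \<in> I +> x" for y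
    proof -
      from y obtain a where a: "a \<in> I" "y = a \<oplus> x" by (auto simp: a_r_coset_def r_coset_def)
      have "a \<in> carrier R" using a I.Icarr by blast
      then have "h y = h (a \<otimes> \<one>) \<oplus>\<^bsub>M\<^esub> h x"
        using cartier_mapsD(2)[OF h] x a by simp
      then show ?thesis
        using kill[OF a(1) R.one_closed] cartier_mapsD(1)[OF h x] by simp
    qed
    then have "h ` (I +> x) = {h x}" using I.a_rcos_self[OF x] by blast
    then show ?thesis by (simp add: g_def)
  qed
  have ann: "h x \<in> annihilated_elements M I" if x: "x \<in> carrier R" for x
  proof -
    have "a \<odot>\<^bsub>M\<^esub> h x = \<zero>\<^bsub>M\<^esub>" if a: "a \<in> I" for a
    proof -
      have a': "a \<in> carrier R" using a I.Icarr by blast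
      obtain n where n: "p ^ e = Suc n" using \<open>0 < p\<close> gr0_conv_Suc[of "p ^ e"] by auto
      have "a [^] (p ^ e) \<in> I" unfolding n using I.I_l_closed[OF a] a' by simp
      then show ?thesis using kill[OF _ x] cartier_mapsD(3)[OF h a' x] by simp
    qed
    then show ?thesis using cartier_mapsD(1)[OF h x] by (simp add: annihilated_elements_def)
  qed
  have "g \<in> cartier_maps p e (R Quot I) (annihilated_module M I)"
    unfolding cartier_maps_iff
  proof (intro conjI ballI funcsetI)
    fix Z Z' assume "Z \<in> carrier (R Quot I)" "Z' \<in> carrier (R Quot I)"
    then obtain x y where x: "x \<in> carrier R" "Z = I +> x" and y: "y \<in> carrier R" "Z' = I +> y"
      unfolding I.quotient_carrier by blast
    show "g (Z \<oplus>\<^bsub>R Quot I\<^esub> Z') = g Z \<oplus>\<^bsub>annihilated_module M I\<^esub> g Z'"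
      using g[of "x \<oplus> y"] g[OF x(1)] g[OF y(1)] x y cartier_mapsD(2)[OF h x(1) y(1)] by simp
    have "Z [^]\<^bsub>R Quot I\<^esub> (p ^ e) \<otimes>\<^bsub>R Quot I\<^esub> Z' = I +> (x [^] (p ^ e) \<otimes> y)"
      using x y by (simp add: pi.ring.hom_nat_pow)
    then have "g (Z [^]\<^bsub>R Quot I\<^esub> (p ^ e) \<otimes>\<^bsub>R Quot I\<^esub> Z') = x \<odot>\<^bsub>M\<^esub> h y"
      using g[of "x [^] (p ^ e) \<otimes> y"] x y cartier_mapsD(3)[OF h x(1) y(1)] by simp
    then show "g (Z [^]\<^bsub>R Quot I\<^esub> (p ^ e) \<otimes>\<^bsub>R Quot I\<^esub> Z') = Z \<odot>\<^bsub>annihilated_module M I\<^esub> g Z'"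
      using annihilated_module_smult[OF module_axioms I x(1) ann[OF y(1)]] g[OF y(1)] x y by simp
  next
    fix Z assume "Z \<in> carrier (R Quot I)"
    then show "g Z \<in> carrier (annihilated_module M I)"
      unfolding I.quotient_carrier using g ann by auto
  qed
  then show ?thesis using g by blast
qed

end

section \<open>Decomposition along the minimal primes\<close>

lemma (in noetherian_cring) one_avoids_minimal_primes:
  assumes "\<one> \<noteq> \<zero>"
  shows "\<one> \<in> avoiding_minimal_primes R"
proof -
  have "\<one> \<notin> P" if "P \<in> minimal_primes R" for P
  proof -
    interpret primeideal P R using that by (simp add: minimal_primes_def)
    show ?thesis using one_imp_carrier I_notcarr by blast
  qed
  then show ?thesis by (simp add: avoiding_minimal_primes_def)
qed

text \<open>An element avoiding the minimal primes of \<open>R\<close> is nonzero modulo \<open>P\<close>, so it is an admissible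
  \<open>c\<close> for the domain \<open>R/P\<close>; Cartier maps over \<open>R/P\<close> inflate to \<open>R\<close>.\<close>

lemma quotient_tight_interior_subset:
  fixes R (structure) and M :: "('a, 'b) module"
  assumes "module_over R M" and P: "P \<in> minimal_primes R"
  shows "tight_interior p (R Quot P) (annihilated_module M P) \<subseteq> tight_interior p R M"
proof
  interpret module_over R M by fact
  interpret P: primeideal P R using P by (simp add: minimal_primes_def)
  interpret S: module_over "R Quot P" "annihilated_module M P"
    by (rule annihilated_module_over[OF P.is_ideal])
  fix z assume z: "z \<in> tight_interior p (R Quot P) (annihilated_module M P)"
  have "z \<in> tight_interior_at p R M c e" if c: "c \<in> avoiding_minimal_primes R" for c e
  proof -
    have c': "c \<in> carrier R" "c \<notin> P"
      using c P by (auto simp: avoiding_minimal_primes_def)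
    have "P +> c \<in> avoiding_minimal_primes (R Quot P)"
      unfolding domain.avoiding_minimal_primes_domain[OF P.quotient_is_domain]
      using P.rcos_eq_zero_iff[OF c'(1)] c' P.quotient_carrier by auto
    then have "z \<in> tight_interior_at p (R Quot P) (annihilated_module M P) (P +> c) e"
      using z by (simp add: tight_interior_def)
    then have "z \<in> tight_interior_at p R M c e \<inter> annihilated_elements M P"
    proof (rule S.tight_interior_at_least)
      fix e' g assume e: "e \<le> e'" and g: "g \<in> cartier_maps p e' (R Quot P) (annihilated_module M P)"
      have "P +> c \<in> carrier (R Quot P)" using c'(1) P.quotient_carrier by auto
      then show "g (P +> c) \<in> tight_interior_at p R M c e \<inter> annihilated_elements M P"
        using tight_interior_at_memI[OF inflate_cartier_map[OF P.is_ideal g] e c'(1)]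
          cartier_mapsD(1)[OF g, of "P +> c"] by simp
    next
      show "\<zero>\<^bsub>annihilated_module M P\<^esub> \<in> tight_interior_at p R M c e \<inter> annihilated_elements M P"
        using zero_in_tight_interior_at S.M.zero_closed by simp
    next
      fix x y assume "x \<in> tight_interior_at p R M c e \<inter> annihilated_elements M P"
        "y \<in> tight_interior_at p R M c e \<inter> annihilated_elements M P"
      then show "x \<oplus>\<^bsub>annihilated_module M P\<^esub> y \<in> tight_interior_at p R M c e \<inter> annihilated_elements M P"
        using tight_interior_at_add[OF _ _ c'(1)] S.M.a_closed[of x y] by simp
    qed simp
    then show ?thesis by blast
  qed
  then show "z \<in> tight_interior p R M" by (simp add: tight_interior_def)
qed

text \<open>This trades \<open>k\<close> levels of a Cartier map for a Frobenius power in its argument. For large \<open>k\<close> the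
  new map vanishes on all nilpotent elements, so it sees only \<open>R\<^sub>r\<^sub>e\<^sub>d\<close>.\<close>

lemma root_cartier_map:
  fixes R (structure) and M :: "('a, 'b) module"
  assumes "module_over R M" "prime_char_cring R p"
    and g: "g \<in> cartier_maps p (e + k) R M"
  shows "(\<lambda>x. g (x [^] (p ^ k))) \<in> cartier_maps p e R M"
proof -
  interpret module_over R M by fact
  interpret prime_char_cring R p by fact
  show ?thesis
    unfolding cartier_maps_iff
  proof (intro conjI ballI funcsetI)
    fix x assume x: "x \<in> carrier R"
    show "g (x [^] (p ^ k)) \<in> carrier M" using cartier_mapsD(1)[OF g] x by simp
    fix y assume y: "y \<in> carrier R"
    show "g ((x \<oplus> y) [^] (p ^ k)) = g (x [^] (p ^ k)) \<oplus>\<^bsub>M\<^esub> g (y [^] (p ^ k))"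
      using cartier_mapsD(2)[OF g] x y by (simp add: frobenius_add)
    have "(x [^] (p ^ e) \<otimes> y) [^] (p ^ k) = x [^] (p ^ (e + k)) \<otimes> y [^] (p ^ k)"
      using x y by (simp add: R.nat_pow_distrib R.nat_pow_pow power_add)
    then show "g ((x [^] (p ^ e) \<otimes> y) [^] (p ^ k)) = x \<odot>\<^bsub>M\<^esub> g (y [^] (p ^ k))"
      using cartier_mapsD(3)[OF g x, of "y [^] (p ^ k)"] y by simp
  qed
qed

lemma (in noetherian_cring) ex_separating_element:
  assumes P: "P \<in> minimal_primes R"
  shows "\<exists>u\<in>carrier R. u \<notin> P \<and> (\<forall>Q\<in>minimal_primes R - {P}. u \<in> Q)"
proof -
  interpret P: primeideal P R using P by (simp add: minimal_primes_def)
  show ?thesis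
  proof (rule P.ex_mem_ideals_not_mem_prime)
    show "finite (minimal_primes R - {P})" using finite_minimal_primes by simp
    show "ideal Q R" if "Q \<in> minimal_primes R - {P}" for Q
      using that primeideal.axioms(1) by (auto simp: minimal_primes_def)
    show "\<not> Q \<subseteq> P" if "Q \<in> minimal_primes R - {P}" for Q
      using that P by (auto simp: minimal_primes_def)
  qed
qed

text \<open>Modulo \<open>P\<close> only the summand with index \<open>P\<close> survives, and it is a product of two elements
  outside \<open>P\<close>.\<close>

lemma (in noetherian_cring) separated_sum_avoids_minimal_primes:
  assumes u: "\<And>P. P \<in> minimal_primes R \<Longrightarrow> u P \<in> carrier R \<and> u P \<notin> P \<and> (\<forall>Q\<in>minimal_primes R - {P}. u P \<in> Q)"
    and d: "\<And>P. P \<in> minimal_primes R \<Longrightarrow> d P \<in> carrier R \<and> d P \<notin> P"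
  shows "(\<Oplus>P\<in>minimal_primes R. u P \<otimes> d P) \<in> avoiding_minimal_primes R"
proof -
  let ?c = "\<Oplus>P\<in>minimal_primes R. u P \<otimes> d P"
  have ud: "(\<lambda>P. u P \<otimes> d P) \<in> minimal_primes R \<rightarrow> carrier R" using u d by auto
  have "?c \<notin> P" if P: "P \<in> minimal_primes R" for P
  proof
    assume c: "?c \<in> P"
    interpret P: primeideal P R using P by (simp add: minimal_primes_def)
    let ?rest = "\<Oplus>Q\<in>minimal_primes R - {P}. u Q \<otimes> d Q"
    have rest: "?rest \<in> P"
    proof (rule P.finsum_mem)
      fix Q assume "Q \<in> minimal_primes R - {P}"
      then show "u Q \<otimes> d Q \<in> P" using u[of Q] d[of Q] P P.I_r_closed[of "u Q" "d Q"] by auto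
    qed
    have uP: "u P \<otimes> d P \<in> carrier R" using u[OF P] d[OF P] by simp
    have "minimal_primes R = insert P (minimal_primes R - {P})" using P by blast
    then have "?c = (\<Oplus>Q\<in>insert P (minimal_primes R - {P}). u Q \<otimes> d Q)" by simp
    also have "\<dots> = u P \<otimes> d P \<oplus> ?rest"
      using ud uP finite_minimal_primes by (intro finsum_insert) auto
    finally have "u P \<otimes> d P = ?c \<ominus> ?rest"
      using uP P.Icarr[OF rest] by (simp add: minus_eq a_assoc r_neg)
    also have "\<dots> \<in> P" using c rest by (simp add: minus_eq P.a_closed)
    finally show False using P.I_prime u[OF P] d[OF P] by blast
  qed
  then show ?thesis using ud by (simp add: avoiding_minimal_primes_def)
qed

lemma power_avoids_minimal_primes:
  assumes "c \<in> avoiding_minimal_primes R"  "cring R"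
  shows "c [^]\<^bsub>R\<^esub> (n::nat) \<in> avoiding_minimal_primes R"
proof -
  interpret cring R by fact
  have c: "c \<in> carrier R" using assms(1) by (simp add: avoiding_minimal_primes_def)
  have "c [^]\<^bsub>R\<^esub> n \<notin> P" if "P \<in> minimal_primes R" for P
    using that assms(1) primeideal.pow_mem[of P R c n] c
    by (auto simp: minimal_primes_def avoiding_minimal_primes_def)
  then show ?thesis using c by (simp add: avoiding_minimal_primes_def)
qed

theorem proposition2p8:
  fixes R :: "'a ring" and M :: "('a, 'b) module" and p :: nat
  assumes "cring R" and "noetherian_ring R"
    and "Factorial_Ring.prime p" and "has_characteristic R p"
    and "F_finite p (reduced_ring R)"
    and "module R M"
  shows "tight_interior p R M =
    submodule_sum M (minimal_primes R)
      (\<lambda>P. tight_interior p (R Quot P) (annihilated_module M P))"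
proof -
  interpret R: cring R by fact
  have "[n] \<cdot>\<^bsub>R\<^esub> \<one>\<^bsub>R\<^esub> = \<zero>\<^bsub>R\<^esub> \<longleftrightarrow> p dvd n" for n :: nat
    using assms(4) by (simp add: has_characteristic_def)
  from this[of p] this[of 1] have char: "[p] \<cdot>\<^bsub>R\<^esub> \<one>\<^bsub>R\<^esub> = \<zero>\<^bsub>R\<^esub>"
    and nontriv: "\<one>\<^bsub>R\<^esub> \<noteq> \<zero>\<^bsub>R\<^esub>"
    using assms(3) by auto
  have pc: "prime_char_cring R p"
    by (intro prime_char_cring.intro prime_char_cring_axioms.intro assms char)
  have nc: "noetherian_cring R"
    by (intro noetherian_cring.intro assms)
  have mo: "module_over R M"
    using assms(6) by (simp add: module_over_def)
  interpret N: noetherian_cring R by (rule nc)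
  interpret F: prime_char_cring R p by (rule pc)
  interpret M: module_over R M by (rule mo)
  let ?T = "\<lambda>P. tight_interior p (R Quot P) (annihilated_module M P)"
  let ?at = "\<lambda>P c. tight_interior_at p (R Quot P) (annihilated_module M P) c 0"
  have prime: "primeideal P R" "ideal P R" if "P \<in> minimal_primes R" for P
    using that primeideal.axioms(1) by (auto simp: minimal_primes_def)
  have S: "F_finite_noetherian_domain (R Quot P) p" if "P \<in> minimal_primes R" for P
    by (rule quotient_F_finite_noetherian_domain[OF nc pc assms(5) that])
  have T_sub: "?T P \<subseteq> tight_interior p R M" if "P \<in> minimal_primes R" for P
    by (rule quotient_tight_interior_subset[OF mo that])
  have "avoiding_minimal_primes R \<noteq> {}"
    using N.one_avoids_minimal_primes[OF nontriv] by blast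
  note submodule = M.tight_interior_submodule[OF this, where p = p]
  \<comment> \<open>Addition in \<open>annihilated_module M P\<close> is that of \<open>M\<close>, so closure of each tight interior
    over \<open>R/P\<close> can be used inside \<open>M\<close>.\<close>
  have T_sum: "x \<oplus>\<^bsub>M\<^esub> y \<in> submodule_sum M (minimal_primes R) ?T"
    if "x \<in> submodule_sum M (minimal_primes R) ?T" "y \<in> submodule_sum M (minimal_primes R) ?T" for x y
    using that
  proof (rule M.submodule_sum_add)
    fix P assume P: "P \<in> minimal_primes R"
    interpret A: module_over "R Quot P" "annihilated_module M P"
      by (rule M.annihilated_module_over[OF prime(2)[OF P]])
    interpret D: F_finite_noetherian_domain "R Quot P" p by (rule S[OF P])
    have ne: "avoiding_minimal_primes (R Quot P) \<noteq> {}"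
      using D.avoiding_minimal_primes_domain D.one_not_zero A.R.one_closed by blast
    show "?T P \<subseteq> carrier M" using T_sub[OF P] submodule(1) by blast
    show "\<zero>\<^bsub>M\<^esub> \<in> ?T P" using A.tight_interior_submodule(2)[OF ne] by simp
    show "x \<oplus>\<^bsub>M\<^esub> y \<in> ?T P" if "x \<in> ?T P" "y \<in> ?T P" for x y
      using A.tight_interior_submodule(3)[OF ne that] by simp
  qed
  show ?thesis
  proof (intro equalityI subsetI)
    fix z assume "z \<in> submodule_sum M (minimal_primes R) ?T"
    then show "z \<in> tight_interior p R M"
      by (rule M.submodule_sum_least) (use T_sub submodule in auto)
  next
    fix z assume z: "z \<in> tight_interior p R M"
    have "\<exists>d. d \<in> carrier R \<and> d \<notin> P \<and> ?at P (P +>\<^bsub>R\<^esub> d) \<subseteq> ?T P"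
      if P: "P \<in> minimal_primes R" for P
    proof -
      interpret D: F_finite_noetherian_domain "R Quot P" p by (rule S[OF P])
      interpret P: ideal P R by (rule prime(2)[OF P])
      interpret A: module_over "R Quot P" "annihilated_module M P"
        by (rule M.annihilated_module_over[OF prime(2)[OF P]])
      obtain c where c: "c \<in> carrier (R Quot P)" "c \<noteq> \<zero>\<^bsub>R Quot P\<^esub>" "?at P c \<subseteq> ?T P"
        using D.ex_test_element A.module_axioms by metis
      obtain d where d: "d \<in> carrier R" "c = P +>\<^bsub>R\<^esub> d"
        using c(1) P.quotient_carrier by blast
      have "d \<notin> P" using c(2) P.rcos_eq_zero_iff[OF d(1)] d(2) by simp
      then show ?thesis using c(3) d by blast
    qed
    then have "\<forall>P\<in>minimal_primes R. \<exists>d. d \<in> carrier R \<and> d \<notin> P \<and> ?at P (P +>\<^bsub>R\<^esub> d) \<subseteq> ?T P"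
      by (rule ballI)
    from bchoice[OF this] obtain d where
      d: "\<And>P. P \<in> minimal_primes R \<Longrightarrow> d P \<in> carrier R \<and> d P \<notin> P"
      and d_test: "\<And>P. P \<in> minimal_primes R \<Longrightarrow> ?at P (P +>\<^bsub>R\<^esub> d P) \<subseteq> ?T P" by blast
    have "\<forall>P\<in>minimal_primes R. \<exists>u. u \<in> carrier R \<and> u \<notin> P \<and> (\<forall>Q\<in>minimal_primes R - {P}. u \<in> Q)"
      using N.ex_separating_element by blast
    from bchoice[OF this] obtain u where u: "\<And>P. P \<in> minimal_primes R \<Longrightarrow>
      u P \<in> carrier R \<and> u P \<notin> P \<and> (\<forall>Q\<in>minimal_primes R - {P}. u P \<in> Q)" by blast
    define c where "c = (\<Oplus>\<^bsub>R\<^esub>P\<in>minimal_primes R. u P \<otimes>\<^bsub>R\<^esub> d P)"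
    have c: "c \<in> avoiding_minimal_primes R"
      unfolding c_def by (rule N.separated_sum_avoids_minimal_primes[OF u d])
    obtain k :: nat where k: "\<forall>x\<in>carrier R. (\<forall>P\<in>minimal_primes R. x \<in> P) \<longrightarrow> x [^]\<^bsub>R\<^esub> k = \<zero>\<^bsub>R\<^esub>"
      using N.intersection_minimal_primes_nilpotent by blast
    \<comment> \<open>The exponent \<open>k\<close> itself serves as a level, because \<open>k \<le> p\<^sup>k\<close>.\<close>
    have kill: "x [^]\<^bsub>R\<^esub> (p ^ k) = \<zero>\<^bsub>R\<^esub>"
      if "x \<in> carrier R" "\<forall>P\<in>minimal_primes R. x \<in> P" for x
    proof -
      have "k \<le> p ^ k" using prime_ge_2_nat[OF assms(3)] self_le_ge2_pow by blast
      then have "x [^]\<^bsub>R\<^esub> (p ^ k) = x [^]\<^bsub>R\<^esub> k \<otimes>\<^bsub>R\<^esub> x [^]\<^bsub>R\<^esub> (p ^ k - k)"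
        using that(1) by (simp add: R.nat_pow_mult)
      then show ?thesis using k that by simp
    qed
    have "z \<in> tight_interior_at p R M (c [^]\<^bsub>R\<^esub> (p ^ k)) k"
      using z power_avoids_minimal_primes[OF c assms(1)] by (auto simp: tight_interior_def)
    then show "z \<in> submodule_sum M (minimal_primes R) ?T"
    proof (rule M.tight_interior_at_least)
      show "submodule_sum M (minimal_primes R) ?T \<subseteq> carrier M"
      proof
        fix x assume "x \<in> submodule_sum M (minimal_primes R) ?T"
        then show "x \<in> carrier M"
          by (rule M.submodule_sum_closed) (use T_sub submodule(1) in blast)
      qed
      show "\<zero>\<^bsub>M\<^esub> \<in> submodule_sum M (minimal_primes R) ?T" by (rule M.zero_in_submodule_sum)
      fix e g assume "k \<le> e" and "g \<in> cartier_maps p e R M"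
      then have g: "g \<in> cartier_maps p ((e - k) + k) R M" by simp
      \<comment> \<open>The value \<open>g (c\<^sup>q)\<close> is \<open>h c\<close>, and \<open>h\<close> is additive, so it splits into the values
        \<open>h (u P \<otimes> d P)\<close>.\<close>
      define h where "h x = g (x [^]\<^bsub>R\<^esub> (p ^ k))" for x
      have h: "h \<in> cartier_maps p (e - k) R M"
        using root_cartier_map[OF mo pc g] by (simp add: h_def[abs_def])
      have part: "h (u P \<otimes>\<^bsub>R\<^esub> d P) \<in> submodule_sum M (minimal_primes R) ?T"
        if P: "P \<in> minimal_primes R" for P
      proof -
        interpret P: primeideal P R by (rule prime(1)[OF P])
        interpret A: module_over "R Quot P" "annihilated_module M P"
          by (rule M.annihilated_module_over[OF prime(2)[OF P]])
        have uP: "u P \<in> carrier R" and dP: "d P \<in> carrier R" using u[OF P] d[OF P] by auto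
        \<comment> \<open>Since \<open>u P\<close> lies in all other minimal primes, \<open>u P \<otimes> a\<close> lies in all of them.\<close>
        have "h (u P \<otimes>\<^bsub>R\<^esub> (a \<otimes>\<^bsub>R\<^esub> x)) = \<zero>\<^bsub>M\<^esub>" if a: "a \<in> P" and x: "x \<in> carrier R" for a x
        proof -
          have a': "a \<in> carrier R" using a P.Icarr by blast
          have "u P \<otimes>\<^bsub>R\<^esub> (a \<otimes>\<^bsub>R\<^esub> x) \<in> Q" if Q: "Q \<in> minimal_primes R" for Q
          proof (cases "Q = P")
            case True
            then show ?thesis using P.I_l_closed[OF P.I_r_closed[OF a x] uP] by simp
          next
            case False
            interpret Q: ideal Q R by (rule prime(2)[OF Q])
            have "u P \<in> Q" using u[OF P] Q False by blast
            then show ?thesis using a' x by (intro Q.I_r_closed) auto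
          qed
          then show ?thesis
            using kill[of "u P \<otimes>\<^bsub>R\<^esub> (a \<otimes>\<^bsub>R\<^esub> x)"] uP a' x M.cartier_map_zero[OF g]
            by (simp add: h_def)
        qed
        then obtain g' where g': "g' \<in> cartier_maps p (e - k) (R Quot P) (annihilated_module M P)"
          and g'_eq: "\<And>x. x \<in> carrier R \<Longrightarrow> g' (P +>\<^bsub>R\<^esub> x) = h (u P \<otimes>\<^bsub>R\<^esub> x)"
          using M.deflate_cartier_map[OF prime(2)[OF P] M.cartier_map_mult_arg[OF h uP]]
            prime_gt_0_nat[OF assms(3)] by blast
        have "P +>\<^bsub>R\<^esub> d P \<in> carrier (R Quot P)" using dP P.quotient_carrier by blast
        then have "h (u P \<otimes>\<^bsub>R\<^esub> d P) \<in> ?T P"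
          using A.tight_interior_at_memI[OF g', of 0 "P +>\<^bsub>R\<^esub> d P"] g'_eq[OF dP] d_test[OF P] by auto
        then show ?thesis
          using T_sub[OF P] submodule(1) by (intro M.submodule_sum_memI[OF P]) auto
      qed
      have "h (\<Oplus>\<^bsub>R\<^esub>P\<in>F. u P \<otimes>\<^bsub>R\<^esub> d P) \<in> submodule_sum M (minimal_primes R) ?T"
        if "finite F" "F \<subseteq> minimal_primes R" for F
        using that
      proof (induction F)
        case empty
        then show ?case using M.cartier_map_zero[OF h] M.zero_in_submodule_sum by simp
      next
        case (insert P F)
        have ud: "u Q \<otimes>\<^bsub>R\<^esub> d Q \<in> carrier R" if "Q \<in> insert P F" for Q
          using that insert.prems u[of Q] d[of Q] by auto
        then have "(\<Oplus>\<^bsub>R\<^esub>Q\<in>insert P F. u Q \<otimes>\<^bsub>R\<^esub> d Q) = u P \<otimes>\<^bsub>R\<^esub> d P \<oplus>\<^bsub>R\<^esub> (\<Oplus>\<^bsub>R\<^esub>Q\<in>F. u Q \<otimes>\<^bsub>R\<^esub> d Q)"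
          using insert.hyps by (intro R.finsum_insert) auto
        moreover have "(\<Oplus>\<^bsub>R\<^esub>Q\<in>F. u Q \<otimes>\<^bsub>R\<^esub> d Q) \<in> carrier R" using ud by (intro R.finsum_closed) auto
        ultimately show ?case
          using cartier_mapsD(2)[OF h ud[of P]] part[of P] insert T_sum by simp
      qed
      from this[OF N.finite_minimal_primes subset_refl]
      show "g (c [^]\<^bsub>R\<^esub> (p ^ k)) \<in> submodule_sum M (minimal_primes R) ?T"
        by (simp add: h_def c_def)
    qed (rule T_sum)
  qed
qed

end
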